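(* Let $(X_t)_{t\ge 0}$, $(\mathbb{P}_x)_{x\in E}$ be an irreducible Markov jump process on the finite set $E$ with invariant distribution $\pi$ and generator $L$, let $f:E\to\mathbb{R}$ be non-constant with $\pi(f)=0$, let $\nu$ be a probability measure on $E$, and let $A_t=\int_0^t f(X_s)\,ds$ for $t>0$. Let $f^+=\max\{0,f\}$. Then for all $u\ge0$ $$\mathbb{P}_\nu\left(\frac{A_t}{t}\ge u\right)\le\left\|\frac{d\nu}{d\pi}\right\|_2\exp\left(-\frac{2tu^2}{\hat\sigma_f^2\left(1+\sqrt{1+\frac{2\|f^+\|_\infty u}{\lambda_1\hat\sigma_f^2}}\right)^2}\right).$$ Furthermore, $$\lambda_0(r)\le\frac{r^2\,\hat\sigma_f^2/2}{1-\left(\frac{\|f^+\|_\infty}{\lambda_1}\right)r}\qquad\text{for all }0\le r<\frac{\lambda_1}{\|f^+\|_\infty}.$$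
   Context: $E$ is a finite set with at least two elements. A Markov jump process (MJP) on $E$ is an $E$-valued process $(X_t)_{t\ge0}$ with right-continuous (piecewise constant) paths together with probability measures $(\mathbb{P}_x)_{x\in E}$ such that $\mathbb{P}_x(X_0=x)=1$ and the (time-homogeneous) Markov property holds. Its transition function is $p_{xy}(t)=\mathbb{P}_x(X_t=y)=(\exp(tQ))_{xy}$ for a unique matrix $Q=(q_{xy})$ with $q_{xy}\ge0$ for $x\ne y$ and $\sum_y q_{xy}=0$. It is irreducible if $p_{xy}(t)>0$ for all $x,y\in E$, $t>0$; then it has a unique invariant distribution $\pi$ ($\pi^TQ=0$), and $\pi_x>0$ for all $x$. Write $\mathbb{P}_\nu=\sum_x\nu_x\mathbb{P}_x$ for a probability measure $\nu$ on $E$, and $\mu(g)=\int g\,d\mu$. $L^2(\pi)$ is the real space of all functions $E\to\mathbb{R}$ with inner product $\langle g,h\rangle=\sum_x g(x)h(x)\pi_x$ and norm $\|\cdot\|_2$; $\|g\|_\infty=\max_x|g(x)|$. The infinitesimal generator $L$ is the operator on $L^2(\pi)$ given by $(Lg)(x)=\sum_y q_{xy}g(y)$, and $L^*$ is its adjoint in $L^2(\pi)$. $M_f$ is multiplication by $f$, and $\frac{d\nu}{d\pi}(x)=\nu_x/\pi_x$. For $r\in\mathbb{R}$, $\lambda_0(r)$ denotes the largest eigenvalue of the self-adjoint operator $\frac{L+L^*}{2}+rM_f$ on $L^2(\pi)$. The self-adjoint operator $\frac{L+L^*}{2}$ is negative semidefinite with simple eigenvalue $0$ (eigenspace: constants).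 Its spectral gap is $\lambda_1:=\min\{|\lambda|:\lambda\in\sigma(\frac{L+L^*}{2})\setminus\{0\}\}>0$. $S$ denotes the reduced resolvent of $\frac{L+L^*}{2}$ with respect to the eigenvalue $0$, i.e. $S=0$ on constants and $S$ is the inverse of $\frac{L+L^*}{2}$ restricted to the orthogonal complement of the constants. Finally $\hat\sigma_f^2:=-2\langle Sf,f\rangle$. *)

theory Defs
  imports "HOL-Probability.Probability"
begin

section \<open>Markov jump processes on a finite state space\<close>

definition natural_filtration :: "'w measure \<Rightarrow> (real \<Rightarrow> 'w \<Rightarrow> 'e) \<Rightarrow> real \<Rightarrow> 'w measure" where
  "natural_filtration M X s =
     sigma (space M) {X u -` B \<inter> space M |u B. 0 \<le> u \<and> u \<le> s}"

definition transition :: "('e \<Rightarrow> 'w measure) \<Rightarrow> (real \<Rightarrow> 'w \<Rightarrow> 'e) \<Rightarrow> 'e \<Rightarrow> 'e \<Rightarrow> real \<Rightarrow> real" where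
  "transition P X x y t = measure (P x) {\<omega> \<in> space (P x). X t \<omega> = y}"

text \<open>
  Only the underlying measurable space of \<open>M\<close> is used; all \<open>P x\<close> live on it.
  The values of \<open>X\<close> at negative times are irrelevant.
  \<open>E\<close> carries the discrete topology, so right-continuity of a path means that to the right of
  every time it is constant for a while.
\<close>
locale markov_jump_process =
  fixes M :: "'w measure" and P :: "'e::finite \<Rightarrow> 'w measure" and X :: "real \<Rightarrow> 'w \<Rightarrow> 'e"
  assumes prob_space_P: "prob_space (P x)"
    and sets_P: "sets (P x) = sets M"
    and measurable_X: "0 \<le> t \<Longrightarrow> X t \<in> measurable M (count_space UNIV)"
    and right_continuous: "\<omega> \<in> space M \<Longrightarrow> 0 \<le> t \<Longrightarrow> \<forall>\<^sub>F s in at_right t. X s \<omega> = X t \<omega>"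
    and start: "measure (P x) {\<omega> \<in> space M. X 0 \<omega> = x} = 1"
    and markov: "0 \<le> s \<Longrightarrow> 0 \<le> t \<Longrightarrow>
      AE \<omega> in P x.
        real_cond_exp (P x) (natural_filtration M X s)
          (indicator {\<omega>' \<in> space M. X (s + t) \<omega>' = y}) \<omega>
        = transition P X (X s \<omega>) y t"

definition irreducible_process :: "('e \<Rightarrow> 'w measure) \<Rightarrow> (real \<Rightarrow> 'w \<Rightarrow> 'e) \<Rightarrow> bool" where
  "irreducible_process P X \<longleftrightarrow> (\<forall>x y. \<forall>t>0. transition P X x y t > 0)"

definition matrix_exp :: "real ^ 'e ^ 'e \<Rightarrow> real ^ 'e ^ ('e::finite)" where
  "matrix_exp A = (\<Sum>n. (1 / fact n) *\<^sub>R (((**) A ^^ n) (mat 1)))"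

definition is_generator_matrix ::
    "('e::finite \<Rightarrow> 'w measure) \<Rightarrow> (real \<Rightarrow> 'w \<Rightarrow> 'e) \<Rightarrow> real ^ 'e ^ 'e \<Rightarrow> bool" where
  "is_generator_matrix P X Q \<longleftrightarrow>
     (\<forall>x y. x \<noteq> y \<longrightarrow> 0 \<le> Q $ x $ y) \<and>
     (\<forall>x. (\<Sum>y\<in>UNIV. Q $ x $ y) = 0) \<and>
     (\<forall>t\<ge>0. \<forall>x y. transition P X x y t = matrix_exp (t *\<^sub>R Q) $ x $ y)"

definition invariant_distribution :: "real ^ 'e ^ 'e \<Rightarrow> ('e::finite) pmf \<Rightarrow> bool" where
  "invariant_distribution Q \<pi> \<longleftrightarrow> (\<forall>y. (\<Sum>x\<in>UNIV. pmf \<pi> x * Q $ x $ y) = 0)"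

definition prob_from ::
    "('e::finite \<Rightarrow> 'w measure) \<Rightarrow> 'e pmf \<Rightarrow> 'w set \<Rightarrow> real" where
  "prob_from P \<nu> B = (\<Sum>x\<in>UNIV. pmf \<nu> x * measure (P x) B)"

definition additive_functional ::
    "(real \<Rightarrow> 'w \<Rightarrow> 'e) \<Rightarrow> ('e \<Rightarrow> real) \<Rightarrow> real \<Rightarrow> 'w \<Rightarrow> real" where
  "additive_functional X f t \<omega> = (LBINT s:{0..t}. f (X s \<omega>))"

section \<open>Operators on the weighted space of real functions on E\<close>

definition l2_inner :: "'e pmf \<Rightarrow> ('e::finite \<Rightarrow> real) \<Rightarrow> ('e \<Rightarrow> real) \<Rightarrow> real" where
  "l2_inner \<pi> g h = (\<Sum>x\<in>UNIV. g x * h x * pmf \<pi> x)"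

definition l2_norm :: "'e pmf \<Rightarrow> ('e::finite \<Rightarrow> real) \<Rightarrow> real" where
  "l2_norm \<pi> g = sqrt (l2_inner \<pi> g g)"

definition sup_norm :: "('e::finite \<Rightarrow> real) \<Rightarrow> real" where
  "sup_norm g = Max (range (\<lambda>x. \<bar>g x\<bar>))"

definition rel_density :: "'e pmf \<Rightarrow> 'e pmf \<Rightarrow> 'e \<Rightarrow> real" where
  "rel_density \<nu> \<pi> x = pmf \<nu> x / pmf \<pi> x"

definition pos_part :: "('e \<Rightarrow> real) \<Rightarrow> 'e \<Rightarrow> real" where
  "pos_part f x = max 0 (f x)"

definition generator :: "real ^ 'e ^ 'e \<Rightarrow> ('e::finite \<Rightarrow> real) \<Rightarrow> ('e \<Rightarrow> real)" where
  "generator Q g = (\<lambda>x. \<Sum>y\<in>UNIV. Q $ x $ y * g y)"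

text \<open>
  The counterpart of the library's \<^const>\<open>adjoint\<close> for the weighted inner product; unique when
  \<open>\<pi>\<close> has full support.
\<close>
definition l2_adjoint ::
    "'e pmf \<Rightarrow> (('e::finite \<Rightarrow> real) \<Rightarrow> ('e \<Rightarrow> real)) \<Rightarrow> (('e \<Rightarrow> real) \<Rightarrow> ('e \<Rightarrow> real))" where
  "l2_adjoint \<pi> T = (SOME T'. \<forall>g h. l2_inner \<pi> (T g) h = l2_inner \<pi> g (T' h))"

definition sym_generator ::
    "'e pmf \<Rightarrow> real ^ 'e ^ 'e \<Rightarrow> ('e::finite \<Rightarrow> real) \<Rightarrow> ('e \<Rightarrow> real)" where
  "sym_generator \<pi> Q g = (\<lambda>x. (generator Q g x + l2_adjoint \<pi> (generator Q) g x) / 2)"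

text \<open>
  All operators whose spectrum is taken below are self-adjoint on a finite-dimensional space, so
  the spectrum consists of real eigenvalues.
\<close>
definition spectrum :: "(('e \<Rightarrow> real) \<Rightarrow> ('e \<Rightarrow> real)) \<Rightarrow> real set" where
  "spectrum T = {l. \<exists>g. g \<noteq> (\<lambda>_. 0) \<and> T g = (\<lambda>x. l * g x)}"

definition lambda0 :: "'e pmf \<Rightarrow> real ^ 'e ^ 'e \<Rightarrow> ('e::finite \<Rightarrow> real) \<Rightarrow> real \<Rightarrow> real" where
  "lambda0 \<pi> Q f r = Max (spectrum (\<lambda>g x. sym_generator \<pi> Q g x + r * (f x * g x)))"

definition spectral_gap :: "'e pmf \<Rightarrow> real ^ 'e ^ ('e::finite) \<Rightarrow> real" where
  "spectral_gap \<pi> Q = Min (abs ` (spectrum (sym_generator \<pi> Q) - {0}))"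

definition const_complement :: "'e pmf \<Rightarrow> ('e::finite \<Rightarrow> real) set" where
  "const_complement \<pi> = {h. l2_inner \<pi> h (\<lambda>_. 1) = 0}"

text \<open>
  The component of \<open>g\<close> along the constants is \<open>\<pi>(g)\<close>; it is sent to \<open>0\<close>, and the
  component in the orthogonal complement is sent to its unique preimage there.
\<close>
definition reduced_resolvent ::
    "'e pmf \<Rightarrow> real ^ 'e ^ 'e \<Rightarrow> ('e::finite \<Rightarrow> real) \<Rightarrow> ('e \<Rightarrow> real)" where
  "reduced_resolvent \<pi> Q g =
     the_inv_into (const_complement \<pi>) (sym_generator \<pi> Q)
       (\<lambda>x. g x - measure_pmf.expectation \<pi> g)"

definition sigma2 :: "'e pmf \<Rightarrow> real ^ 'e ^ 'e \<Rightarrow> ('e::finite \<Rightarrow> real) \<Rightarrow> real" where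
  "sigma2 \<pi> Q f = - 2 * l2_inner \<pi> (reduced_resolvent \<pi> Q f) f"

end

theory Submission
  imports Defs
begin

text \<open>
  Write \<open>T = (L + L*)/2\<close>, \<open>F = \<parallel>f\<^sup>+\<parallel>\<close> for the sup norm and \<open>D h = - \<langle>T h, h\<rangle>\<close> for the Dirichlet form.
  Both claims follow from one estimate (\<open>perturbed_form_bound\<close>): for \<open>0 \<le> r < \<lambda>\<^sub>1 / F\<close> and every \<open>g\<close>,
  \<open>\<langle>T g, g\<rangle> + r \<langle>f g, g\<rangle> \<le> c(r) \<langle>g, g\<rangle>\<close>, where \<open>c(r) = (r\<^sup>2 \<sigma>\<^sup>2 / 2) / (1 - (F / \<lambda>\<^sub>1) r)\<close>.
  It is elementary. Split \<open>g = a + h\<close> with \<open>a\<close> constant and \<open>h\<close> of mean zero. As \<open>\<pi>(f) = 0\<close>,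
  the form on the left is \<open>- D h + r \<langle>f h, h\<rangle> + 2 r a \<langle>f, h\<rangle>\<close>. The bound \<open>f \<le> F\<close> and the gap give
  \<open>\<langle>f h, h\<rangle> \<le> F \<langle>h, h\<rangle> \<le> (F / \<lambda>\<^sub>1) D h\<close>, and Cauchy-Schwarz for the Dirichlet form, applied to
  \<open>\<langle>f, h\<rangle> = \<langle>T S f, h\<rangle>\<close>, gives \<open>\<langle>f, h\<rangle>\<^sup>2 \<le> (\<sigma>\<^sup>2 / 2) D h\<close>; what remains is a quadratic in \<open>sqrt (D h)\<close>
  whose maximum is \<open>c(r) a\<^sup>2\<close>. Testing with an eigenfunction yields the bound on \<open>\<lambda>\<^sub>0(r)\<close>.

  For the deviation inequality, \<open>A\<^sub>t\<close> is the limit of the Riemann sums of \<open>f(X)\<close> at the right end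
  points of the grid of width \<open>h = t / n\<close>: the end points approach each time from the right, so right-continuity
  of the paths suffices (\<open>riemann_sum_tendsto\<close>). By the Markov property the exponential moment of such a
  sum is the \<open>n\<close>-th iterate, applied to the constant \<open>1\<close>, of the kernel \<open>p\<^sub>x\<^sub>y(h) exp (h r f(y))\<close>
  (\<open>skeleton_moment\<close>). At \<open>h = 0\<close> this kernel is the identity with derivative \<open>L + r f\<close>, so the
  form estimate bounds its norm by \<open>exp (h (c(r) + \<epsilon>))\<close> for small \<open>h\<close> (\<open>kernel_growth\<close>), and its
  iterates by \<open>exp (t (c(r) + \<epsilon>))\<close>. This gives \<open>E\<^sub>\<nu> (exp (r A\<^sub>t)) \<le> \<parallel>d\<nu>/d\<pi>\<parallel> exp (t c(r))\<close>
  without a Feynman-Kac formula (\<open>exp_moment_bound\<close>). Chernoff's bound then leaves the exponent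
  \<open>t (c(r) - r u)\<close>, which is minimized in \<open>bernstein_exponent\<close>.
\<close>

section \<open>Self-adjoint operators on Euclidean spaces\<close>

lemma selfadjoint_imp_linear:
  fixes A :: "'a::real_inner \<Rightarrow> 'a"
  assumes sym: "\<And>x y. A x \<bullet> y = x \<bullet> A y"
  shows "linear A"
proof (rule linearI)
  fix x y :: 'a and c :: real
  have "A (x + y) \<bullet> z = (A x + A y) \<bullet> z" for z
    by (simp add: sym inner_add_left)
  then show "A (x + y) = A x + A y"
    using vector_eq_rdot by blast
  have "A (c *\<^sub>R x) \<bullet> z = (c *\<^sub>R A x) \<bullet> z" for z
    by (simp add: sym)
  then show "A (c *\<^sub>R x) = c *\<^sub>R A x"
    using vector_eq_rdot by blast
qed

text \<open>
  The Rayleigh quotient attains its maximum on the unit sphere of \<open>W\<close> by compactness, and a maximizer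
  is an eigenvector.
\<close>
lemma selfadjoint_max_eigenvalue:
  fixes A :: "'a::euclidean_space \<Rightarrow> 'a"
  assumes sym: "\<And>x y. A x \<bullet> y = x \<bullet> A y"
    and W: "subspace W" "W \<noteq> {0}" "\<And>w. w \<in> W \<Longrightarrow> A w \<in> W"
  obtains m v where "v \<in> W" "v \<noteq> 0" "A v = m *\<^sub>R v" "\<And>w. w \<in> W \<Longrightarrow> A w \<bullet> w \<le> m * (w \<bullet> w)"
proof -
  have lin: "linear A" by (rule selfadjoint_imp_linear[OF sym])
  then have cont: "continuous_on S A" for S
    using linear_continuous_on linear_linear by blast
  obtain w0 where w0: "w0 \<in> W" "w0 \<noteq> 0"
    using W(1,2) subspace_0 by blast
  have "compact (sphere 0 1 \<inter> W)"
    using closed_subspace[OF W(1)] by (simp add: compact_Int_closed)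
  moreover have "w0 /\<^sub>R norm w0 \<in> sphere 0 1 \<inter> W"
    using w0 W(1) by (simp add: subspace_scale)
  moreover have "continuous_on (sphere 0 1 \<inter> W) (\<lambda>w. A w \<bullet> w)"
    by (intro continuous_intros cont)
  ultimately obtain v where v: "v \<in> sphere 0 1 \<inter> W"
    and max: "\<And>w. w \<in> sphere 0 1 \<inter> W \<Longrightarrow> A w \<bullet> w \<le> A v \<bullet> v"
    using continuous_attains_sup[of "sphere 0 1 \<inter> W" "\<lambda>w. A w \<bullet> w"] by blast
  define m where "m = A v \<bullet> v"
  have vW: "v \<in> W" and nv: "v \<bullet> v = 1"
    using v by (auto simp: norm_eq_1)
  have le: "A w \<bullet> w \<le> m * (w \<bullet> w)" if "w \<in> W" for w
  proof (cases "w = 0")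
    case False
    then have "w /\<^sub>R norm w \<in> sphere 0 1 \<inter> W"
      using that W(1) by (simp add: subspace_scale)
    from max[OF this] have "(A w \<bullet> w) / (norm w)\<^sup>2 \<le> m"
      using lin by (simp add: linear_cmul m_def power2_eq_square divide_inverse mult_ac)
    then show ?thesis
      using False by (simp add: power2_norm_eq_inner divide_le_eq)
  qed (use lin in \<open>simp add: linear_0\<close>)
  define z where "z = m *\<^sub>R v - A v"
  have zW: "z \<in> W"
    unfolding z_def using vW W by (intro subspace_diff subspace_scale) auto
  \<comment> \<open>The form \<open>m |w|\<^sup>2 - A w \<bullet> w\<close> is nonnegative on \<open>W\<close> and vanishes at \<open>v\<close>, so its
      derivative at \<open>v\<close> in the direction \<open>z\<close> is zero; this derivative is \<open>2 |z|\<^sup>2\<close>.\<close>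
  define q where "q = m * (z \<bullet> z) - A z \<bullet> z"
  have q: "0 \<le> q" using le[OF zW] by (simp add: q_def)
  have expand: "0 \<le> 2 * s * (z \<bullet> z) + s\<^sup>2 * q" for s
  proof -
    have "v + s *\<^sub>R z \<in> W" using vW zW W(1) by (simp add: subspace_add subspace_scale)
    from le[OF this]
    have "0 \<le> m * ((v + s *\<^sub>R z) \<bullet> (v + s *\<^sub>R z)) - A (v + s *\<^sub>R z) \<bullet> (v + s *\<^sub>R z)"
      by simp
    also have "\<dots> = 2 * s * ((m *\<^sub>R v - A v) \<bullet> z) + s\<^sup>2 * q"
      using lin nv sym[of v z]
      by (simp add: linear_add linear_cmul inner_simps q_def m_def power2_eq_square
          inner_commute algebra_simps)
    finally show ?thesis by (simp add: z_def)
  qed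
  have "z \<bullet> z \<le> 0"
  proof (rule ccontr)
    assume "\<not> z \<bullet> z \<le> 0"
    then have pos: "z \<bullet> z > 0" by (simp only: not_le)
    \<comment> \<open>a negative step small enough for the linear term to dominate; \<open>q + 1\<close> avoids the case \<open>q = 0\<close>\<close>
    define s where "s = - (z \<bullet> z) / (q + 1)"
    have "s < 0" using pos q by (simp add: s_def field_simps)
    moreover have "2 * (z \<bullet> z) + s * q > 0"
    proof -
      have "- (s * q) \<le> z \<bullet> z" using pos q by (simp add: s_def field_simps)
      then show ?thesis using pos by linarith
    qed
    ultimately have "s * (2 * (z \<bullet> z) + s * q) < 0" by (rule mult_neg_pos)
    with expand[of s] show False by (simp add: algebra_simps power2_eq_square)
  qed
  then have "z = 0" using inner_gt_zero_iff[of z] by linarith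
  then have "A v = m *\<^sub>R v" by (simp add: z_def)
  moreover have "v \<noteq> 0" using nv by auto
  ultimately show thesis using that vW le by blast
qed

text \<open>
  Eigenvectors of distinct eigenvalues are orthogonal, hence independent, so their number is at most
  the dimension.
\<close>
lemma selfadjoint_finite_eigenvalues:
  fixes A :: "'a::euclidean_space \<Rightarrow> 'a"
  assumes sym: "\<And>x y. A x \<bullet> y = x \<bullet> A y"
  shows "finite {l. \<exists>v. v \<noteq> 0 \<and> A v = l *\<^sub>R v}" (is "finite ?S")
proof -
  define e where "e l = (SOME v. v \<noteq> 0 \<and> A v = l *\<^sub>R v)" for l
  have e: "e l \<noteq> 0" "A (e l) = l *\<^sub>R e l" if "l \<in> ?S" for l
    using someI_ex[of "\<lambda>v. v \<noteq> 0 \<and> A v = l *\<^sub>R v"] that by (auto simp: e_def)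
  have orth: "e l \<bullet> e k = 0" if "l \<in> ?S" "k \<in> ?S" "l \<noteq> k" for l k
    using sym[of "e l" "e k"] e[OF that(1)] e[OF that(2)] that(3) by simp
  have inj: "inj_on e ?S"
    using orth e(1) by (metis (no_types, lifting) inj_onI inner_eq_zero_iff)
  have "pairwise orthogonal (e ` ?S)"
    using orth by (auto simp: pairwise_def orthogonal_def)
  then have "independent (e ` ?S)"
    using e(1) by (intro pairwise_orthogonal_independent) (metis (no_types, lifting) imageE)+
  then have "finite (e ` ?S)"
    using independent_bound by blast
  then show ?thesis
    using inj finite_imageD by blast
qed

section \<open>Self-adjoint operators on the weighted space\<close>

lemma l2_inner_commute: "l2_inner \<pi> g h = l2_inner \<pi> h g"
  by (simp add: l2_inner_def mult.commute)

lemma l2_inner_add_left: "l2_inner \<pi> (\<lambda>x. g x + g' x) h = l2_inner \<pi> g h + l2_inner \<pi> g' h"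
  by (simp add: l2_inner_def algebra_simps sum.distrib)

lemma l2_inner_scale_left: "l2_inner \<pi> (\<lambda>x. c * g x) h = c * l2_inner \<pi> g h"
  by (simp add: l2_inner_def algebra_simps sum_distrib_left)

lemma l2_inner_add_right: "l2_inner \<pi> g (\<lambda>x. h x + h' x) = l2_inner \<pi> g h + l2_inner \<pi> g h'"
  by (simp add: l2_inner_def algebra_simps sum.distrib)

lemma l2_inner_scale_right: "l2_inner \<pi> g (\<lambda>x. c * h x) = c * l2_inner \<pi> g h"
  by (simp add: l2_inner_def algebra_simps sum_distrib_left)

lemmas l2_inner_simps =
  l2_inner_add_left l2_inner_scale_left l2_inner_add_right l2_inner_scale_right

lemma l2_inner_nonneg: "0 \<le> l2_inner \<pi> g g"
  unfolding l2_inner_def by (intro sum_nonneg) auto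

lemma l2_inner_one_one: "l2_inner \<pi> (\<lambda>_. 1) (\<lambda>_. 1) = 1"
  using sum_pmf_eq_1[of UNIV \<pi>] by (simp add: l2_inner_def)

lemma expectation_eq_l2_inner_one: "measure_pmf.expectation \<pi> g = l2_inner \<pi> g (\<lambda>_. 1)"
  for g :: "'e::finite \<Rightarrow> real"
  by (subst integral_measure_pmf_real[where A = UNIV]) (auto simp: l2_inner_def)

lemma l2_cauchy_schwarz: "l2_inner \<pi> g h \<le> l2_norm \<pi> g * l2_norm \<pi> h"
proof -
  have "l2_inner \<pi> g h = (\<Sum>x\<in>UNIV. (sqrt (pmf \<pi> x) * g x) * (sqrt (pmf \<pi> x) * h x))"
    unfolding l2_inner_def by (intro sum.cong) (auto simp: algebra_simps simp flip: power2_eq_square)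
  also have "\<dots> \<le> sqrt (\<Sum>x\<in>UNIV. (sqrt (pmf \<pi> x) * g x)\<^sup>2) * sqrt (\<Sum>x\<in>UNIV. (sqrt (pmf \<pi> x) * h x)\<^sup>2)"
    unfolding L2_set_def[symmetric]
    by (rule order_trans[OF sum_mono L2_set_mult_ineq]) (simp flip: abs_mult)
  also have "\<dots> = l2_norm \<pi> g * l2_norm \<pi> h"
    by (simp add: l2_norm_def l2_inner_def power_mult_distrib power2_eq_square mult.commute mult.left_commute)
  finally show ?thesis .
qed

lemma le_sup_norm_pos_part: "f x \<le> sup_norm (pos_part f)"
proof -
  have "f x \<le> \<bar>pos_part f x\<bar>" by (simp add: pos_part_def)
  also have "\<dots> \<le> sup_norm (pos_part f)" unfolding sup_norm_def by (intro Max_ge) auto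
  finally show ?thesis .
qed

locale full_support =
  fixes \<pi> :: "'e::finite pmf"
  assumes pmf_pos: "0 < pmf \<pi> x"
begin

lemma l2_inner_self_eq_0: "l2_inner \<pi> g g = 0 \<longleftrightarrow> g = (\<lambda>_. 0)"
proof -
  have "l2_inner \<pi> g g = 0 \<longleftrightarrow> (\<forall>x\<in>UNIV. g x * g x * pmf \<pi> x = 0)"
    unfolding l2_inner_def by (intro sum_nonneg_eq_0_iff) (auto intro: less_imp_le pmf_pos)
  also have "\<dots> \<longleftrightarrow> g = (\<lambda>_. 0)"
    using pmf_pos by (auto simp: less_le)
  finally show ?thesis .
qed

lemma l2_inner_self_pos: "g \<noteq> (\<lambda>_. 0) \<Longrightarrow> 0 < l2_inner \<pi> g g"
  using l2_inner_self_eq_0[of g] l2_inner_nonneg[of \<pi> g] by linarith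

text \<open>
  Multiplication by the square root of the weights is an isometry onto the standard Euclidean space; it
  carries over the results on self-adjoint operators proved there.
\<close>
definition to_vec :: "('e \<Rightarrow> real) \<Rightarrow> real ^ 'e" where
  "to_vec g = (\<chi> x. sqrt (pmf \<pi> x) * g x)"

definition of_vec :: "real ^ 'e \<Rightarrow> 'e \<Rightarrow> real" where
  "of_vec v = (\<lambda>x. v $ x / sqrt (pmf \<pi> x))"

lemma pmf_nonzero [simp]: "pmf \<pi> x \<noteq> 0"
  using pmf_pos[of x] by simp

lemma of_to_vec [simp]: "of_vec (to_vec g) = g"
  by (simp add: of_vec_def to_vec_def)

lemma to_of_vec [simp]: "to_vec (of_vec v) = v"
  by (simp add: of_vec_def to_vec_def vec_eq_iff)

lemma to_vec_inner: "to_vec g \<bullet> to_vec h = l2_inner \<pi> g h"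
  unfolding inner_vec_def to_vec_def l2_inner_def
  by (intro sum.cong) (auto simp: algebra_simps simp flip: power2_eq_square)

lemma to_vec_scale: "to_vec (\<lambda>x. c * g x) = c *\<^sub>R to_vec g"
  by (simp add: to_vec_def vec_eq_iff)

lemma to_vec_eq_iff: "to_vec g = to_vec h \<longleftrightarrow> g = h"
  by (metis of_to_vec)

lemma to_vec_eq_0_iff: "to_vec g = 0 \<longleftrightarrow> g = (\<lambda>_. 0)"
  by (metis l2_inner_self_eq_0 inner_eq_zero_iff to_vec_inner)

lemma l2_eqI: "(\<And>k. l2_inner \<pi> g k = l2_inner \<pi> h k) \<Longrightarrow> g = h"
  by (metis to_of_vec of_to_vec to_vec_inner vector_eq_rdot)

text \<open>
  The maximum is over the orthogonal complement of \<open>c\<close>: \<open>c = 1\<close> produces the spectral gap, and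
  \<open>c = 0\<close> the top of the spectrum on the whole space.
\<close>
lemma l2_max_eigenvalue:
  assumes sym: "\<And>g h. l2_inner \<pi> (T g) h = l2_inner \<pi> g (T h)"
    and inv: "\<And>g. l2_inner \<pi> g c = 0 \<Longrightarrow> l2_inner \<pi> (T g) c = 0"
    and nontriv: "g0 \<noteq> (\<lambda>_. 0)" "l2_inner \<pi> g0 c = 0"
  obtains m g where "g \<noteq> (\<lambda>_. 0)" "l2_inner \<pi> g c = 0" "T g = (\<lambda>x. m * g x)"
    "\<And>h. l2_inner \<pi> h c = 0 \<Longrightarrow> l2_inner \<pi> (T h) h \<le> m * l2_inner \<pi> h h"
proof -
  define A where "A v = to_vec (T (of_vec v))" for v
  define W where "W = {v. v \<bullet> to_vec c = 0}"
  have A_sym: "A x \<bullet> y = x \<bullet> A y" for x y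
    using sym[of "of_vec x" "of_vec y"] by (simp add: A_def flip: to_vec_inner)
  have sub: "subspace W"
    unfolding W_def subspace_def by (auto simp: inner_simps)
  have "to_vec g0 \<in> W" "to_vec g0 \<noteq> 0"
    using nontriv by (auto simp: W_def to_vec_inner to_vec_eq_0_iff)
  then have nz: "W \<noteq> {0}" by blast
  have A_W: "A w \<in> W" if "w \<in> W" for w
    using inv[of "of_vec w"] that by (simp add: W_def A_def flip: to_vec_inner)
  obtain m v where v: "v \<in> W" "v \<noteq> 0" "A v = m *\<^sub>R v"
    "\<And>w. w \<in> W \<Longrightarrow> A w \<bullet> w \<le> m * (w \<bullet> w)"
    by (rule selfadjoint_max_eigenvalue[OF A_sym sub nz A_W]) blast+
  show thesis
  proof (rule that[of "of_vec v" m])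
    show "of_vec v \<noteq> (\<lambda>_. 0)" using v(2) by (metis to_of_vec to_vec_eq_0_iff)
    show "l2_inner \<pi> (of_vec v) c = 0" using v(1) by (simp add: W_def flip: to_vec_inner)
    have "to_vec (T (of_vec v)) = to_vec (\<lambda>x. m * of_vec v x)"
      using v(3) by (simp add: A_def to_vec_scale)
    then show "T (of_vec v) = (\<lambda>x. m * of_vec v x)" by (simp add: to_vec_eq_iff)
    show "l2_inner \<pi> (T h) h \<le> m * l2_inner \<pi> h h" if "l2_inner \<pi> h c = 0" for h
      using v(4)[of "to_vec h"] that by (simp add: W_def A_def to_vec_inner)
  qed
qed

lemma finite_spectrum:
  assumes sym: "\<And>g h. l2_inner \<pi> (T g) h = l2_inner \<pi> g (T h)"
  shows "finite (spectrum T)"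
proof -
  define A where "A v = to_vec (T (of_vec v))" for v
  have "A x \<bullet> y = x \<bullet> A y" for x y
    using sym[of "of_vec x" "of_vec y"] by (simp add: A_def flip: to_vec_inner)
  then have "finite {l. \<exists>v. v \<noteq> 0 \<and> A v = l *\<^sub>R v}"
    by (rule selfadjoint_finite_eigenvalues)
  moreover have "spectrum T \<subseteq> {l. \<exists>v. v \<noteq> 0 \<and> A v = l *\<^sub>R v}"
  proof
    fix l assume "l \<in> spectrum T"
    then obtain g where "g \<noteq> (\<lambda>_. 0)" "T g = (\<lambda>x. l * g x)" by (auto simp: spectrum_def)
    then have "to_vec g \<noteq> 0 \<and> A (to_vec g) = l *\<^sub>R to_vec g"
      by (simp add: A_def to_vec_eq_0_iff to_vec_scale)
    then show "l \<in> {l. \<exists>v. v \<noteq> 0 \<and> A v = l *\<^sub>R v}" by blast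
  qed
  ultimately show ?thesis by (rule finite_subset[rotated])
qed

text \<open>
  A nonpositive function of mean zero vanishes, because every weight is positive.
\<close>
lemma sup_norm_pos_part_pos:
  assumes "l2_inner \<pi> f (\<lambda>_. 1) = 0" "f \<noteq> (\<lambda>_. 0)"
  shows "0 < sup_norm (pos_part f)"
proof (rule ccontr)
  assume not: "\<not> 0 < sup_norm (pos_part f)"
  have "f x \<le> 0" for x
    using not le_sup_norm_pos_part[of f x] by simp
  moreover have "(\<Sum>x\<in>UNIV. - f x * pmf \<pi> x) = 0"
    using assms(1) by (simp add: l2_inner_def sum_negf)
  ultimately have "\<forall>x\<in>UNIV. - f x * pmf \<pi> x = 0"
    by (subst (asm) sum_nonneg_eq_0_iff) (auto intro!: mult_nonneg_nonneg simp: mult_nonpos_nonneg)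
  then have "f = (\<lambda>_. 0)" by (auto simp: fun_eq_iff)
  with assms(2) show False by contradiction
qed

end

section \<open>The symmetrized generator\<close>

text \<open>
  Irreducibility is replaced by two of its consequences, the full support of \<open>\<pi>\<close> and, as the last
  property, a Liouville theorem: harmonic functions are constant.
\<close>
locale ergodic_generator = full_support \<pi> for \<pi> :: "'e::finite pmf" +
  fixes Q :: "real ^ 'e ^ 'e"
  assumes card: "2 \<le> CARD('e)"
    and off_diag: "x \<noteq> y \<Longrightarrow> 0 \<le> Q $ x $ y"
    and row_sum: "(\<Sum>y\<in>UNIV. Q $ x $ y) = 0"
    and invariant: "invariant_distribution Q \<pi>"
    and harmonic_const: "generator Q g = (\<lambda>_. 0) \<Longrightarrow> g x = g y"
begin

abbreviation "T \<equiv> sym_generator \<pi> Q"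
abbreviation "one \<equiv> (\<lambda>_::'e. 1::real)"

text \<open>
  The adjoint of a matrix for the weighted inner product is an explicit matrix, so the choice made
  in the definition of the adjoint is from a nonempty set.
\<close>
lemma adjoint: "l2_inner \<pi> (generator Q g) h = l2_inner \<pi> g (l2_adjoint \<pi> (generator Q) h)"
proof -
  define T' where "T' h = (\<lambda>y. (\<Sum>x\<in>UNIV. pmf \<pi> x * Q $ x $ y * h x) / pmf \<pi> y)" for h
  have "l2_inner \<pi> (generator Q g) h = l2_inner \<pi> g (T' h)" for g h
  proof -
    have "l2_inner \<pi> (generator Q g) h = (\<Sum>x\<in>UNIV. \<Sum>y\<in>UNIV. Q $ x $ y * g y * h x * pmf \<pi> x)"
      by (simp add: l2_inner_def generator_def sum_distrib_right)
    also have "\<dots> = (\<Sum>y\<in>UNIV. \<Sum>x\<in>UNIV. Q $ x $ y * g y * h x * pmf \<pi> x)"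
      by (rule sum.swap)
    also have "\<dots> = (\<Sum>y\<in>UNIV. g y * (\<Sum>x\<in>UNIV. pmf \<pi> x * Q $ x $ y * h x))"
      by (simp add: sum_distrib_left mult_ac)
    also have "\<dots> = l2_inner \<pi> g (T' h)"
      by (simp add: l2_inner_def T'_def)
    finally show ?thesis .
  qed
  then have "\<forall>g h. l2_inner \<pi> (generator Q g) h = l2_inner \<pi> g (T' h)" by blast
  then show ?thesis
    unfolding l2_adjoint_def
    using someI[of "\<lambda>T'. \<forall>g h. l2_inner \<pi> (generator Q g) h = l2_inner \<pi> g (T' h)" T'] by blast
qed

lemma T_inner: "l2_inner \<pi> (T g) h = (l2_inner \<pi> (generator Q g) h + l2_inner \<pi> g (generator Q h)) / 2"
proof -
  have "l2_inner \<pi> (T g) h =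
      (l2_inner \<pi> (generator Q g) h + l2_inner \<pi> (l2_adjoint \<pi> (generator Q) g) h) / 2"
    by (simp add: l2_inner_def sym_generator_def algebra_simps sum.distrib add_divide_distrib
        sum_divide_distrib)
  then show ?thesis
    using adjoint[of h g] by (simp add: l2_inner_commute)
qed

lemma T_selfadjoint: "l2_inner \<pi> (T g) h = l2_inner \<pi> g (T h)"
  using T_inner[of g h] T_inner[of h g] by (simp add: l2_inner_commute)

lemma T_add: "T (\<lambda>x. g x + h x) = (\<lambda>x. T g x + T h x)"
  by (rule l2_eqI) (simp add: T_selfadjoint l2_inner_simps)

lemma T_scale: "T (\<lambda>x. c * g x) = (\<lambda>x. c * T g x)"
  by (rule l2_eqI) (simp add: T_selfadjoint l2_inner_simps)

lemma T_quadratic: "l2_inner \<pi> (T g) g = l2_inner \<pi> (generator Q g) g"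
  by (simp add: T_inner l2_inner_commute[of \<pi> g "generator Q g"])

lemma generator_one: "generator Q one = (\<lambda>_. 0)"
  by (simp add: generator_def row_sum)

text \<open>
  This is invariance of \<open>\<pi>\<close>, tested against functions.
\<close>
lemma generator_mean_zero: "l2_inner \<pi> (generator Q g) one = 0"
proof -
  have "l2_inner \<pi> (generator Q g) one = (\<Sum>x\<in>UNIV. \<Sum>y\<in>UNIV. pmf \<pi> x * Q $ x $ y * g y)"
    by (simp add: l2_inner_def generator_def sum_distrib_left sum_distrib_right mult_ac)
  also have "\<dots> = (\<Sum>y\<in>UNIV. (\<Sum>x\<in>UNIV. pmf \<pi> x * Q $ x $ y) * g y)"
    by (subst sum.swap) (simp add: sum_distrib_right)
  also have "\<dots> = 0"
    using invariant by (simp add: invariant_distribution_def)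
  finally show ?thesis .
qed

lemma T_one: "T one = (\<lambda>_. 0)"
proof (rule l2_eqI)
  show "l2_inner \<pi> (T one) k = l2_inner \<pi> (\<lambda>_. 0) k" for k
    using generator_mean_zero[of k]
    by (simp add: T_inner generator_one l2_inner_commute[of _ one]) (simp add: l2_inner_def)
qed

lemma T_mean_zero: "l2_inner \<pi> (T g) one = 0"
  by (simp add: T_selfadjoint T_one) (simp add: l2_inner_def)

text \<open>
  Expand the square: the term in \<open>(g x)\<^sup>2\<close> vanishes because the rows of \<open>Q\<close> sum to zero, the term in
  \<open>(g y)\<^sup>2\<close> because \<open>\<pi>\<close> is invariant.
\<close>
lemma T_dirichlet:
  "l2_inner \<pi> (T g) g = - (\<Sum>x\<in>UNIV. \<Sum>y\<in>UNIV. pmf \<pi> x * Q $ x $ y * (g x - g y)\<^sup>2) / 2"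
proof -
  have "(\<Sum>x\<in>UNIV. \<Sum>y\<in>UNIV. pmf \<pi> x * Q $ x $ y * (g x - g y)\<^sup>2)
      = (\<Sum>x\<in>UNIV. \<Sum>y\<in>UNIV. Q $ x $ y * (pmf \<pi> x * (g x)\<^sup>2))
        + (\<Sum>x\<in>UNIV. \<Sum>y\<in>UNIV. Q $ x $ y * (g y)\<^sup>2 * 1 * pmf \<pi> x)
        - 2 * (\<Sum>x\<in>UNIV. \<Sum>y\<in>UNIV. Q $ x $ y * g y * g x * pmf \<pi> x)"
    unfolding sum_distrib_left sum.distrib[symmetric] sum_subtractf[symmetric]
    by (intro sum.cong refl) (simp add: power2_eq_square algebra_simps)
  also have "(\<Sum>x\<in>UNIV. \<Sum>y\<in>UNIV. Q $ x $ y * (pmf \<pi> x * (g x)\<^sup>2)) = 0"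
    by (simp add: row_sum flip: sum_distrib_right)
  also have "(\<Sum>x\<in>UNIV. \<Sum>y\<in>UNIV. Q $ x $ y * (g y)\<^sup>2 * 1 * pmf \<pi> x)
      = l2_inner \<pi> (generator Q (\<lambda>y. (g y)\<^sup>2)) one"
    by (simp add: l2_inner_def generator_def sum_distrib_right)
  also have "\<dots> = 0" by (rule generator_mean_zero)
  also have "(\<Sum>x\<in>UNIV. \<Sum>y\<in>UNIV. Q $ x $ y * g y * g x * pmf \<pi> x) = l2_inner \<pi> (T g) g"
    unfolding T_quadratic by (simp add: l2_inner_def generator_def sum_distrib_right)
  finally show ?thesis by simp
qed

lemma dirichlet_term_nonneg: "0 \<le> pmf \<pi> x * Q $ x $ y * (g x - g y)\<^sup>2"
  using off_diag[of x y] pmf_pos[of x] by (cases "x = y") auto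

lemma T_nonpos: "l2_inner \<pi> (T g) g \<le> 0"
  unfolding T_dirichlet by (simp add: sum_nonneg dirichlet_term_nonneg)

text \<open>
  If the Dirichlet form vanishes at \<open>g\<close>, then \<open>g x = g y\<close> whenever a jump from \<open>x\<close> to \<open>y\<close> is
  possible. Such a \<open>g\<close> is harmonic for \<open>Q\<close> itself, which reduces the kernel of the symmetrization to
  that of the generator.
\<close>
lemma T_kernel:
  assumes "l2_inner \<pi> (T g) g = 0"
  shows "g x = g y"
proof (rule harmonic_const)
  have "\<forall>x\<in>UNIV. (\<Sum>y\<in>UNIV. pmf \<pi> x * Q $ x $ y * (g x - g y)\<^sup>2) = 0"
    using assms unfolding T_dirichlet
    by (subst sum_nonneg_eq_0_iff[symmetric]) (auto intro!: sum_nonneg dirichlet_term_nonneg)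
  then have "\<forall>y\<in>UNIV. pmf \<pi> x * Q $ x $ y * (g x - g y)\<^sup>2 = 0" for x
    by (subst sum_nonneg_eq_0_iff[symmetric]) (auto intro!: dirichlet_term_nonneg)
  then have "pmf \<pi> x * Q $ x $ y * (g x - g y)\<^sup>2 = 0" for x y
    by blast
  then have zero: "Q $ x $ y * (g y - g x) = 0" for x y
    by (metis diff_self mult_eq_0_iff power_eq_0_iff pmf_nonzero minus_diff_eq neg_0_equal_iff_equal)
  have "generator Q g x = (\<Sum>y\<in>UNIV. Q $ x $ y * (g y - g x)) + (\<Sum>y\<in>UNIV. Q $ x $ y) * g x" for x
    unfolding generator_def sum_distrib_right sum.distrib[symmetric]
    by (intro sum.cong) (auto simp: algebra_simps)
  then show "generator Q g = (\<lambda>_. 0)"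
    unfolding zero by (simp add: row_sum fun_eq_iff)
qed

lemma T_kernel_mean_zero:
  assumes "T g = (\<lambda>_. 0)" "l2_inner \<pi> g one = 0"
  shows "g = (\<lambda>_. 0)"
proof -
  have "l2_inner \<pi> (T g) g = 0" using assms(1) by (simp add: l2_inner_def)
  then have c: "g x = g y" for x y by (rule T_kernel)
  have "g x = 0" for x
  proof -
    have "g = (\<lambda>y. g x * 1)" using c by auto
    then have "l2_inner \<pi> g one = l2_inner \<pi> (\<lambda>y. g x * 1) one" by (rule arg_cong)
    then have "l2_inner \<pi> g one = g x * l2_inner \<pi> one one"
      by (simp only: l2_inner_scale_left)
    then show ?thesis using assms(2) by (simp add: l2_inner_one_one)
  qed
  then show ?thesis by blast
qed

lemma nontrivial_mean_zero:
  obtains g where "g \<noteq> (\<lambda>_. 0)" "l2_inner \<pi> g one = 0"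
proof -
  obtain a b :: 'e where ab: "a \<noteq> b"
    using card ex_card[of 2 "UNIV::'e set"] by (auto simp: card_2_iff)
  define g where "g x = indicator {a} x - l2_inner \<pi> (indicator {a}) one" for x :: 'e
  have "l2_inner \<pi> (\<lambda>x. indicator {a} x + (- l2_inner \<pi> (indicator {a}) one) * 1) one = 0"
    unfolding l2_inner_simps l2_inner_one_one by simp
  then have "l2_inner \<pi> g one = 0" by (simp add: g_def[abs_def])
  moreover have "g a \<noteq> g b" using ab by (simp add: g_def)
  then have "g \<noteq> (\<lambda>_. 0)" by auto
  ultimately show thesis using that by blast
qed

text \<open>
  The maximal eigenvalue of \<open>T\<close> on the functions of mean zero is a negative member of the spectrum, so
  it lies at least the gap below \<open>0\<close>.
\<close>
lemma spectral_gap: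
  shows spectral_gap_pos: "0 < spectral_gap \<pi> Q"
    and spectral_gap_le: "l2_inner \<pi> h one = 0 \<Longrightarrow>
      spectral_gap \<pi> Q * l2_inner \<pi> h h \<le> - l2_inner \<pi> (T h) h"
proof -
  obtain g0 where g0: "g0 \<noteq> (\<lambda>_. 0)" "l2_inner \<pi> g0 one = 0" by (rule nontrivial_mean_zero)
  obtain m g where g: "g \<noteq> (\<lambda>_. 0)" "l2_inner \<pi> g one = 0" "T g = (\<lambda>x. m * g x)"
    and max: "\<And>h. l2_inner \<pi> h one = 0 \<Longrightarrow> l2_inner \<pi> (T h) h \<le> m * l2_inner \<pi> h h"
    by (rule l2_max_eigenvalue[OF T_selfadjoint T_mean_zero g0]) blast
  have "m \<noteq> 0" using T_kernel_mean_zero[of g] g by auto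
  moreover have "m * l2_inner \<pi> g g \<le> 0"
    using T_nonpos[of g] unfolding g(3) l2_inner_simps .
  ultimately have m: "m < 0"
    using l2_inner_self_pos[OF g(1)] by (simp add: mult_le_0_iff)
  have fin: "finite (abs ` (spectrum T - {0}))"
    using finite_spectrum[OF T_selfadjoint] by simp
  have mem: "\<bar>m\<bar> \<in> abs ` (spectrum T - {0})"
    using g m by (intro imageI) (auto simp: spectrum_def)
  then have "spectral_gap \<pi> Q \<in> abs ` (spectrum T - {0})"
    unfolding spectral_gap_def using fin by (intro Min_in) auto
  then show "0 < spectral_gap \<pi> Q" by auto
  have le: "spectral_gap \<pi> Q \<le> - m"
    unfolding spectral_gap_def using Min_le[OF fin mem] m by simp
  assume "l2_inner \<pi> h one = 0"
  from max[OF this] mult_right_mono[OF le l2_inner_nonneg[of \<pi> h]]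
  show "spectral_gap \<pi> Q * l2_inner \<pi> h h \<le> - l2_inner \<pi> (T h) h" by simp
qed

text \<open>
  The operator \<open>T\<close> minus the projection to the constants is injective, hence surjective as the space is
  finite-dimensional; on a right-hand side of mean zero its solution has mean zero, and then solves
  \<open>T g = f\<close>.
\<close>
lemma T_solve:
  assumes "l2_inner \<pi> f one = 0"
  obtains g where "l2_inner \<pi> g one = 0" "T g = f"
proof -
  define A where "A v = to_vec (\<lambda>x. T (of_vec v) x + (- l2_inner \<pi> (of_vec v) one) * 1)" for v
  have lin: "linear A"
  proof (rule selfadjoint_imp_linear)
    show "A x \<bullet> y = x \<bullet> A y" for x y
      using T_selfadjoint[of "of_vec x" "of_vec y"]
        to_vec_inner[of "\<lambda>z. T (of_vec x) z + (- l2_inner \<pi> (of_vec x) one) * 1" "of_vec y"]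
        to_vec_inner[of "of_vec x" "\<lambda>z. T (of_vec y) z + (- l2_inner \<pi> (of_vec y) one) * 1"]
      unfolding A_def by (simp only: to_of_vec l2_inner_simps l2_inner_commute[of _ one]) (simp add: mult.commute)
  qed
  have mean: "l2_inner \<pi> g one = - l2_inner \<pi> k one"
    if "k = (\<lambda>x. T g x + (- l2_inner \<pi> g one) * 1)" for g k
    unfolding that l2_inner_simps T_mean_zero l2_inner_one_one by simp
  have "inj A"
  proof (subst linear_injective_0[OF lin], intro allI impI)
    fix v assume "A v = 0"
    then have z: "(\<lambda>_. 0) = (\<lambda>x. T (of_vec v) x + (- l2_inner \<pi> (of_vec v) one) * 1)"
      by (simp only: A_def to_vec_eq_0_iff)
    from mean[OF z] have 0: "l2_inner \<pi> (of_vec v) one = 0" by (simp add: l2_inner_def)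
    then have "T (of_vec v) = (\<lambda>_. 0)" using z by simp
    then have "of_vec v = (\<lambda>_. 0)" using 0 by (rule T_kernel_mean_zero)
    then show "v = 0" by (metis to_of_vec to_vec_eq_0_iff)
  qed
  then have "surj A" using lin by (simp add: linear_injective_imp_surjective)
  then obtain v where "to_vec f = A v" by (metis surjD)
  then have f: "f = (\<lambda>x. T (of_vec v) x + (- l2_inner \<pi> (of_vec v) one) * 1)"
    by (simp only: A_def to_vec_eq_iff)
  from mean[OF f] assms have 0: "l2_inner \<pi> (of_vec v) one = 0" by simp
  then have "T (of_vec v) = f" using f by simp
  with 0 show thesis using that by blast
qed

lemma reduced_resolvent:
  assumes "l2_inner \<pi> f one = 0"
  shows T_resolvent: "T (reduced_resolvent \<pi> Q f) = f"
    and resolvent_mean_zero: "l2_inner \<pi> (reduced_resolvent \<pi> Q f) one = 0"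
proof -
  obtain g where g: "l2_inner \<pi> g one = 0" "T g = f" using T_solve[OF assms] .
  have inj: "inj_on T (const_complement \<pi>)"
  proof (rule inj_onI)
    fix h k assume h: "h \<in> const_complement \<pi>" and k: "k \<in> const_complement \<pi>" and eq: "T h = T k"
    have "T (\<lambda>x. h x + (-1) * k x) = (\<lambda>_. 0)"
      unfolding T_add T_scale eq by simp
    moreover have "l2_inner \<pi> (\<lambda>x. h x + (-1) * k x) one = 0"
      using h k unfolding l2_inner_simps const_complement_def by simp
    ultimately have "(\<lambda>x. h x + (-1) * k x) = (\<lambda>_. 0)" by (rule T_kernel_mean_zero)
    then show "h = k" by (auto simp: fun_eq_iff)
  qed
  have "reduced_resolvent \<pi> Q f = the_inv_into (const_complement \<pi>) T (T g)"
    unfolding reduced_resolvent_def expectation_eq_l2_inner_one assms g(2) by simp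
  also have "\<dots> = g"
    using g(1) by (intro the_inv_into_f_f[OF inj]) (simp add: const_complement_def)
  finally show "T (reduced_resolvent \<pi> Q f) = f" "l2_inner \<pi> (reduced_resolvent \<pi> Q f) one = 0"
    using g by simp_all
qed

lemma sigma2_nonneg:
  assumes "l2_inner \<pi> f one = 0"
  shows "0 \<le> sigma2 \<pi> Q f"
  using T_nonpos[of "reduced_resolvent \<pi> Q f"]
  by (simp add: sigma2_def T_resolvent[OF assms] l2_inner_commute[of _ f])

lemma sigma2_pos:
  assumes "l2_inner \<pi> f one = 0" "f \<noteq> (\<lambda>_. 0)"
  shows "0 < sigma2 \<pi> Q f"
proof -
  let ?S = "reduced_resolvent \<pi> Q f"
  have "T (\<lambda>x. 0 * 0) = (\<lambda>x. 0 * T (\<lambda>_. 0) x)" by (rule T_scale)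
  then have "T (\<lambda>_. 0) = (\<lambda>_. 0)" by simp
  then have "?S \<noteq> (\<lambda>_. 0)" using T_resolvent[OF assms(1)] assms(2) by metis
  then have "0 < spectral_gap \<pi> Q * l2_inner \<pi> ?S ?S"
    by (intro mult_pos_pos spectral_gap_pos l2_inner_self_pos)
  also have "\<dots> \<le> - l2_inner \<pi> (T ?S) ?S"
    by (rule spectral_gap_le[OF resolvent_mean_zero[OF assms(1)]])
  finally show ?thesis
    by (simp add: sigma2_def T_resolvent[OF assms(1)] l2_inner_commute[of _ f])
qed

text \<open>
  Cauchy-Schwarz for the semidefinite form \<open>- \<langle>T g, h\<rangle>\<close> at \<open>S f\<close> and \<open>h\<close>, where \<open>T S f = f\<close>.
\<close>
lemma resolvent_cauchy_schwarz:
  assumes "l2_inner \<pi> f one = 0"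
  shows "(l2_inner \<pi> f h)\<^sup>2 \<le> sigma2 \<pi> Q f / 2 * (- l2_inner \<pi> (T h) h)"
proof -
  let ?S = "reduced_resolvent \<pi> Q f"
  define a b c where "a = - l2_inner \<pi> (T h) h" and "b = l2_inner \<pi> f h" and "c = sigma2 \<pi> Q f / 2"
  have S: "T ?S = f" by (rule T_resolvent[OF assms])
  \<comment> \<open>the form is nonnegative at \<open>S f + s h\<close>; the discriminant of this quadratic in \<open>s\<close> gives the claim\<close>
  have form: "0 \<le> s\<^sup>2 * a - 2 * s * b + c" for s
  proof -
    have "l2_inner \<pi> (T h) ?S = b"
      unfolding T_selfadjoint S b_def by (rule l2_inner_commute)
    then have "l2_inner \<pi> (T (\<lambda>x. ?S x + s * h x)) (\<lambda>x. ?S x + s * h x) = - (s\<^sup>2 * a - 2 * s * b + c)"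
      unfolding T_add T_scale l2_inner_simps S
      by (simp add: a_def b_def c_def sigma2_def power2_eq_square l2_inner_commute[of _ f] algebra_simps)
    then show ?thesis using T_nonpos[of "\<lambda>x. ?S x + s * h x"] by linarith
  qed
  have "b\<^sup>2 \<le> c * a"
  proof (cases "a = 0")
    case True
    have "b = 0"
    proof (rule ccontr)
      assume "b \<noteq> 0"
      with form[of "(c + 1) / (2 * b)"] True show False by (simp add: field_simps)
    qed
    then show ?thesis using True by simp
  next
    case False
    then have "0 < a" using T_nonpos[of h] by (simp add: a_def)
    then show ?thesis using form[of "b / a"] by (simp add: field_simps power2_eq_square)
  qed
  then show ?thesis by (simp add: a_def b_def c_def)
qed

lemma multiplication_le_sup_norm:
  "l2_inner \<pi> (\<lambda>x. f x * h x) h \<le> sup_norm (pos_part f) * l2_inner \<pi> h h"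
proof -
  have "f x * (h x * h x * pmf \<pi> x) \<le> sup_norm (pos_part f) * (h x * h x * pmf \<pi> x)" for x
    by (intro mult_right_mono le_sup_norm_pos_part) simp
  then show ?thesis
    unfolding l2_inner_def sum_distrib_left by (intro sum_mono) (simp add: mult_ac)
qed

text \<open>
  The estimate behind both parts of the theorem. The mean-zero component \<open>h\<close> of \<open>g\<close> pays for the
  potential: a share \<open>b r\<close> of its Dirichlet energy \<open>D\<close> absorbs \<open>\<langle>f h, h\<rangle>\<close>, and the remaining share
  \<open>c = 1 - b r\<close> absorbs the cross term between \<open>h\<close> and the constant \<open>a\<close>.
\<close>
lemma perturbed_form_bound:
  assumes f: "l2_inner \<pi> f one = 0"
    and r: "0 \<le> r" "sup_norm (pos_part f) / spectral_gap \<pi> Q * r < 1"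
  shows "l2_inner \<pi> (T g) g + r * l2_inner \<pi> (\<lambda>x. f x * g x) g
    \<le> (r\<^sup>2 * sigma2 \<pi> Q f / 2) / (1 - sup_norm (pos_part f) / spectral_gap \<pi> Q * r) * l2_inner \<pi> g g"
proof -
  define F where "F = sup_norm (pos_part f)"
  define b where "b = F / spectral_gap \<pi> Q"
  define a where "a = l2_inner \<pi> g one"
  define h where "h = (\<lambda>x. g x + (- a) * 1)"
  define D where "D = - l2_inner \<pi> (T h) h"
  define q where "q = sigma2 \<pi> Q f / 2"
  have q: "0 \<le> q" using sigma2_nonneg[OF f] by (simp add: q_def)
  have h0: "l2_inner \<pi> h one = 0"
    unfolding h_def l2_inner_simps l2_inner_one_one by (simp add: a_def)
  have g: "g = (\<lambda>x. h x + a * 1)" by (simp add: h_def)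
  have T: "l2_inner \<pi> (T g) g = - D"
    unfolding D_def g T_add T_scale T_one l2_inner_simps
    using T_mean_zero[of h] by (simp add: l2_inner_def)
  have norm: "l2_inner \<pi> g g = a\<^sup>2 + l2_inner \<pi> h h"
    unfolding g l2_inner_simps l2_inner_one_one
    using h0 by (simp add: l2_inner_commute[of \<pi> one h] power2_eq_square)
  have "(\<lambda>x. f x * g x) = (\<lambda>x. f x * h x + a * f x)"
    by (simp add: g algebra_simps)
  then have mult: "l2_inner \<pi> (\<lambda>x. f x * g x) g
      = l2_inner \<pi> (\<lambda>x. f x * h x) h + 2 * a * l2_inner \<pi> f h"
  proof -
    have "l2_inner \<pi> (\<lambda>x. f x * h x) one = l2_inner \<pi> f h" by (simp add: l2_inner_def)
    with \<open>(\<lambda>x. f x * g x) = _\<close> show ?thesis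
      by (simp only: g l2_inner_simps f) simp
  qed
  have F: "0 \<le> F"
    unfolding F_def sup_norm_def by (subst Max_ge_iff) auto
  have D: "0 \<le> D" "spectral_gap \<pi> Q * l2_inner \<pi> h h \<le> D"
    using T_nonpos[of h] spectral_gap_le[OF h0] by (simp_all add: D_def)
  have "F * l2_inner \<pi> h h = b * (spectral_gap \<pi> Q * l2_inner \<pi> h h)"
    using spectral_gap_pos by (simp add: b_def)
  also have "\<dots> \<le> b * D"
    using D(2) F spectral_gap_pos by (intro mult_left_mono) (auto simp: b_def)
  finally have fh: "l2_inner \<pi> (\<lambda>x. f x * h x) h \<le> b * D"
    using multiplication_le_sup_norm[of f h] by (simp add: F_def)
  define c where "c = 1 - b * r"
  have c: "0 < c" using r(2) by (simp add: c_def b_def F_def)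
  have lin: "r * (2 * a * l2_inner \<pi> f h) \<le> c * D + r\<^sup>2 * a\<^sup>2 * q / c"
  proof -
    \<comment> \<open>weighted arithmetic-geometric mean: \<open>2 y z \<le> c y\<^sup>2 + z\<^sup>2 / c\<close>\<close>
    have "(l2_inner \<pi> f h)\<^sup>2 \<le> q * D"
      using resolvent_cauchy_schwarz[OF f, of h] by (simp add: q_def D_def)
    then have "(c * r * (2 * a * l2_inner \<pi> f h))\<^sup>2 \<le> 4 * (c\<^sup>2 * r\<^sup>2 * a\<^sup>2) * (q * D)"
      using mult_left_mono[of "(l2_inner \<pi> f h)\<^sup>2" "q * D" "4 * (c\<^sup>2 * r\<^sup>2 * a\<^sup>2)"]
      by (simp add: power_mult_distrib mult_ac)
    also have "\<dots> \<le> (c\<^sup>2 * D + r\<^sup>2 * a\<^sup>2 * q)\<^sup>2"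
      using zero_le_power2[of "c\<^sup>2 * D - r\<^sup>2 * a\<^sup>2 * q"] by (simp add: power2_eq_square algebra_simps)
    finally have "(c * r * (2 * a * l2_inner \<pi> f h))\<^sup>2 \<le> (c\<^sup>2 * D + r\<^sup>2 * a\<^sup>2 * q)\<^sup>2" .
    moreover have "0 \<le> c\<^sup>2 * D + r\<^sup>2 * a\<^sup>2 * q"
      using D(1) q by (intro add_nonneg_nonneg mult_nonneg_nonneg) simp_all
    ultimately have "c * r * (2 * a * l2_inner \<pi> f h) \<le> c\<^sup>2 * D + r\<^sup>2 * a\<^sup>2 * q"
      by (rule power2_le_imp_le)
    then have "(r * (2 * a * l2_inner \<pi> f h)) * c \<le> c * D * c + r\<^sup>2 * a\<^sup>2 * q"
      by (simp only: power2_eq_square mult_ac)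
    then have "r * (2 * a * l2_inner \<pi> f h) \<le> (c * D * c + r\<^sup>2 * a\<^sup>2 * q) / c"
      using c by (simp only: pos_le_divide_eq)
    also have "\<dots> = c * D + r\<^sup>2 * a\<^sup>2 * q / c"
      using c by (simp add: add_divide_distrib)
    finally show ?thesis .
  qed
  have "l2_inner \<pi> (T g) g + r * l2_inner \<pi> (\<lambda>x. f x * g x) g
      = - D + r * l2_inner \<pi> (\<lambda>x. f x * h x) h + r * (2 * a * l2_inner \<pi> f h)"
    unfolding T mult by (simp add: algebra_simps)
  also have "\<dots> \<le> - D + r * (b * D) + (c * D + r\<^sup>2 * a\<^sup>2 * q / c)"
    using mult_left_mono[OF fh r(1)] lin by linarith
  also have "\<dots> = r\<^sup>2 * q / c * a\<^sup>2" by (simp add: c_def algebra_simps)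
  also have "\<dots> \<le> r\<^sup>2 * q / c * l2_inner \<pi> g g"
  proof (rule mult_left_mono)
    show "a\<^sup>2 \<le> l2_inner \<pi> g g" using norm l2_inner_nonneg[of \<pi> h] by simp
    show "0 \<le> r\<^sup>2 * q / c" using q c by simp
  qed
  finally show ?thesis by (simp add: q_def c_def b_def F_def)
qed

text \<open>
  The largest eigenvalue has an eigenfunction, at which the form equals this eigenvalue times the squared norm.
\<close>
lemma lambda0_le:
  assumes "\<And>g. l2_inner \<pi> (T g) g + r * l2_inner \<pi> (\<lambda>x. f x * g x) g \<le> c * l2_inner \<pi> g g"
  shows "lambda0 \<pi> Q f r \<le> c"
proof -
  let ?T = "\<lambda>g x. T g x + r * (f x * g x)"
  have sym: "l2_inner \<pi> (?T g) h = l2_inner \<pi> g (?T h)" for g h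
  proof -
    have "l2_inner \<pi> (\<lambda>x. f x * g x) h = l2_inner \<pi> g (\<lambda>x. f x * h x)"
      by (simp add: l2_inner_def mult_ac)
    then show ?thesis by (simp add: l2_inner_simps T_selfadjoint)
  qed
  \<comment> \<open>the complement of \<open>0\<close> is the whole space\<close>
  have nontriv: "one \<noteq> (\<lambda>_. 0)" "l2_inner \<pi> one (\<lambda>_. 0) = 0"
    by (auto simp: fun_eq_iff l2_inner_def)
  have "l2_inner \<pi> (?T g) (\<lambda>_. 0) = 0" for g by (simp add: l2_inner_def)
  then obtain m g where "g \<noteq> (\<lambda>_. 0)" "?T g = (\<lambda>x. m * g x)"
    by (rule l2_max_eigenvalue[of ?T "\<lambda>_. 0", OF sym _ nontriv])
  then have "spectrum ?T \<noteq> {}" by (auto simp: spectrum_def)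
  then have "lambda0 \<pi> Q f r \<in> spectrum ?T"
    unfolding lambda0_def using finite_spectrum[of ?T, OF sym] by (intro Max_in)
  then obtain g where g: "g \<noteq> (\<lambda>_. 0)" "?T g = (\<lambda>x. lambda0 \<pi> Q f r * g x)"
    by (auto simp: spectrum_def)
  have "lambda0 \<pi> Q f r * l2_inner \<pi> g g = l2_inner \<pi> (?T g) g"
    unfolding g(2) by (simp add: l2_inner_simps)
  also have "\<dots> \<le> c * l2_inner \<pi> g g"
    using assms[of g] by (simp add: l2_inner_simps)
  finally show ?thesis
    using l2_inner_self_pos[OF g(1)] by simp
qed

end

section \<open>The matrix exponential\<close>

definition matrix_power :: "real ^ 'e ^ 'e \<Rightarrow> nat \<Rightarrow> real ^ 'e ^ ('e::finite)" where
  "matrix_power A n = (((**) A ^^ n) (mat 1))"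

lemma matrix_power_Suc: "matrix_power A (Suc n) $ x $ y = (\<Sum>z\<in>UNIV. A $ x $ z * matrix_power A n $ z $ y)"
  by (simp add: matrix_power_def matrix_matrix_mult_def)

lemma matrix_power_0: "matrix_power A 0 $ x $ y = (if x = y then 1 else 0)"
  by (simp add: matrix_power_def mat_def)

lemma matrix_power_scale: "matrix_power (t *\<^sub>R A) n $ x $ y = t ^ n * matrix_power A n $ x $ y"
  by (induction n arbitrary: x) (simp_all add: matrix_power_0 matrix_power_Suc sum_distrib_left mult_ac)

lemma matrix_power_bound:
  "\<bar>matrix_power A n $ x $ y\<bar> \<le> (\<Sum>x\<in>UNIV. \<Sum>y\<in>UNIV. \<bar>A $ x $ y\<bar>) ^ n"
proof (induction n arbitrary: x)
  case 0
  then show ?case by (simp add: matrix_power_0)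
next
  case (Suc n)
  let ?K = "\<Sum>x\<in>UNIV. \<Sum>y\<in>UNIV. \<bar>A $ x $ y\<bar>"
  have "\<bar>matrix_power A (Suc n) $ x $ y\<bar> \<le> (\<Sum>z\<in>UNIV. \<bar>A $ x $ z\<bar> * \<bar>matrix_power A n $ z $ y\<bar>)"
    unfolding matrix_power_Suc by (rule order_trans[OF sum_abs]) (simp add: abs_mult)
  also have "\<dots> \<le> (\<Sum>z\<in>UNIV. \<bar>A $ x $ z\<bar> * ?K ^ n)"
    by (intro sum_mono mult_left_mono Suc.IH) auto
  also have "\<dots> = (\<Sum>z\<in>UNIV. \<bar>A $ x $ z\<bar>) * ?K ^ n" by (simp add: sum_distrib_right)
  also have "\<dots> \<le> ?K * ?K ^ n"
    by (intro mult_right_mono member_le_sum[of x UNIV "\<lambda>x. \<Sum>z\<in>UNIV. \<bar>A $ x $ z\<bar>"])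
      (auto intro!: sum_nonneg zero_le_power)
  finally show ?case by simp
qed

lemma matrix_exp_summable: "summable (\<lambda>n. matrix_power A n $ x $ y / fact n * t ^ n)"
proof (rule summable_comparison_test'[OF summable_exp])
  let ?K = "\<Sum>x\<in>UNIV. \<Sum>y\<in>UNIV. \<bar>A $ x $ y\<bar>"
  fix n :: nat
  have "\<bar>matrix_power A n $ x $ y\<bar> * \<bar>t\<bar> ^ n \<le> ?K ^ n * \<bar>t\<bar> ^ n"
    by (intro mult_right_mono matrix_power_bound) simp
  then show "norm (matrix_power A n $ x $ y / fact n * t ^ n) \<le> inverse (fact n) * (?K * \<bar>t\<bar>) ^ n"
    by (simp add: abs_mult power_abs power_mult_distrib field_simps)
qed

lemma matrix_exp_sums:
  "(\<lambda>n. matrix_power A n $ x $ y / fact n * t ^ n) sums (matrix_exp (t *\<^sub>R A) $ x $ y)"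
proof -
  define B :: "real ^ 'a ^ 'a" where
    "B = (\<chi> x y. \<Sum>n. matrix_power A n $ x $ y / fact n * t ^ n)"
  have entry: "(\<lambda>n. matrix_power A n $ x $ y / fact n * t ^ n) sums (B $ x $ y)" for x y
    using matrix_exp_summable[of A x y t] by (simp add: B_def summable_sums)
  have "(\<lambda>n. (1 / fact n) *\<^sub>R matrix_power (t *\<^sub>R A) n) sums B"
    unfolding sums_def
  proof (intro vec_tendstoI)
    fix x y
    show "(\<lambda>n. (\<Sum>i<n. (1 / fact i) *\<^sub>R matrix_power (t *\<^sub>R A) i) $ x $ y) \<longlonglongrightarrow> B $ x $ y"
      using entry[of x y] by (simp add: sums_def sum_component matrix_power_scale mult_ac)
  qed
  then have "matrix_exp (t *\<^sub>R A) = B"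
    unfolding matrix_exp_def matrix_power_def[symmetric] by (rule sums_unique[symmetric])
  then show ?thesis using entry by simp
qed

lemma matrix_exp_0: "matrix_exp (0 *\<^sub>R A) $ x $ y = (if x = y then 1 else 0)"
proof -
  have "(\<lambda>n. matrix_power A n $ x $ y / fact n * 0 ^ n) = (\<lambda>n. if n = 0 then matrix_power A 0 $ x $ y else 0)"
    by auto
  then have "(\<lambda>n. matrix_power A n $ x $ y / fact n * 0 ^ n) sums matrix_power A 0 $ x $ y"
    using sums_If_finite_set[of "{0}" "\<lambda>_. matrix_power A 0 $ x $ y"] by simp
  with matrix_exp_sums[of A x y 0] show ?thesis
    by (simp add: matrix_power_0 sums_unique2)
qed

lemma matrix_exp_deriv_0: "((\<lambda>t. matrix_exp (t *\<^sub>R A) $ x $ y) has_real_derivative A $ x $ y) (at 0)"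
proof -
  let ?c = "\<lambda>n. matrix_power A n $ x $ y / fact n"
  have "(\<lambda>t. \<Sum>n. ?c n * t ^ n) = (\<lambda>t. matrix_exp (t *\<^sub>R A) $ x $ y)"
    by (intro ext sums_unique[symmetric] matrix_exp_sums)
  moreover have "((\<lambda>t. \<Sum>n. ?c n * t ^ n) has_real_derivative (\<Sum>n. diffs ?c n * 0 ^ n)) (at 0)"
    by (rule termdiffs_strong_converges_everywhere) (rule matrix_exp_summable)
  moreover have "(\<Sum>n. diffs ?c n * 0 ^ n) = diffs ?c 0"
    by (rule powser_zero)
  moreover have "diffs ?c 0 = A $ x $ y"
    by (simp add: diffs_def matrix_power_Suc matrix_power_0 if_distrib sum.delta cong: if_cong)
  ultimately show ?thesis by simp
qed

text \<open>
  All terms of the exponential series but the first annihilate a function in the kernel of \<open>A\<close>.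
\<close>
lemma matrix_exp_harmonic:
  assumes "generator A g = (\<lambda>_. 0)"
  shows "(\<Sum>y\<in>UNIV. matrix_exp (t *\<^sub>R A) $ x $ y * g y) = g x"
proof -
  have pow: "(\<Sum>y\<in>UNIV. matrix_power A n $ x $ y * g y) = (if n = 0 then g x else 0)" for n x
  proof (induction n arbitrary: x)
    case 0
    have "(\<Sum>y\<in>UNIV. matrix_power A 0 $ x $ y * g y) = (\<Sum>y\<in>UNIV. if x = y then g y else 0)"
      by (intro sum.cong) (auto simp: matrix_power_0)
    then show ?case by simp
  next
    case (Suc n)
    have "(\<Sum>y\<in>UNIV. matrix_power A (Suc n) $ x $ y * g y)
        = (\<Sum>z\<in>UNIV. A $ x $ z * (\<Sum>y\<in>UNIV. matrix_power A n $ z $ y * g y))"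
      unfolding matrix_power_Suc sum_distrib_left sum_distrib_right
      by (subst sum.swap) (simp add: mult_ac)
    also have "\<dots> = 0"
      unfolding Suc.IH using fun_cong[OF assms, of x] by (cases "n = 0") (simp_all add: generator_def)
    finally show ?case by simp
  qed
  have "(\<lambda>n. \<Sum>y\<in>UNIV. matrix_power A n $ x $ y / fact n * t ^ n * g y)
      sums (\<Sum>y\<in>UNIV. matrix_exp (t *\<^sub>R A) $ x $ y * g y)"
    by (intro sums_sum sums_mult2 matrix_exp_sums)
  also have "(\<lambda>n. \<Sum>y\<in>UNIV. matrix_power A n $ x $ y / fact n * t ^ n * g y)
      = (\<lambda>n. t ^ n / fact n * (\<Sum>y\<in>UNIV. matrix_power A n $ x $ y * g y))"
    by (simp add: sum_distrib_left mult_ac)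
  also have "\<dots> = (\<lambda>n. if n \<in> {0} then g x else 0)"
    by (auto simp: pow)
  finally show ?thesis
    using sums_If_finite_set[of "{0::nat}" "\<lambda>_. g x"] by (auto dest: sums_unique2)
qed

lemma matrix_exp_invariant:
  assumes "invariant_distribution A \<pi>"
  shows "(\<Sum>x\<in>UNIV. pmf \<pi> x * matrix_exp (t *\<^sub>R A) $ x $ y) = pmf \<pi> y"
proof -
  have pow: "(\<Sum>x\<in>UNIV. pmf \<pi> x * matrix_power A n $ x $ y) = (if n = 0 then pmf \<pi> y else 0)" for n
  proof (cases n)
    case 0
    have "(\<Sum>x\<in>UNIV. pmf \<pi> x * matrix_power A 0 $ x $ y) = (\<Sum>x\<in>UNIV. if x = y then pmf \<pi> x else 0)"
      by (intro sum.cong) (auto simp: matrix_power_0)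
    then show ?thesis using 0 by simp
  next
    case (Suc k)
    have "(\<Sum>x\<in>UNIV. pmf \<pi> x * matrix_power A (Suc k) $ x $ y)
        = (\<Sum>z\<in>UNIV. (\<Sum>x\<in>UNIV. pmf \<pi> x * A $ x $ z) * matrix_power A k $ z $ y)"
      unfolding matrix_power_Suc sum_distrib_left sum_distrib_right
      by (subst sum.swap) (simp add: mult_ac)
    then show ?thesis using assms Suc by (simp add: invariant_distribution_def)
  qed
  have "(\<lambda>n. \<Sum>x\<in>UNIV. pmf \<pi> x * (matrix_power A n $ x $ y / fact n * t ^ n))
      sums (\<Sum>x\<in>UNIV. pmf \<pi> x * matrix_exp (t *\<^sub>R A) $ x $ y)"
    by (intro sums_sum sums_mult matrix_exp_sums)
  also have "(\<lambda>n. \<Sum>x\<in>UNIV. pmf \<pi> x * (matrix_power A n $ x $ y / fact n * t ^ n))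
      = (\<lambda>n. t ^ n / fact n * (\<Sum>x\<in>UNIV. pmf \<pi> x * matrix_power A n $ x $ y))"
    by (simp add: sum_distrib_left mult_ac)
  also have "\<dots> = (\<lambda>n. if n \<in> {0} then pmf \<pi> y else 0)"
    by (auto simp: pow)
  finally show ?thesis
    using sums_If_finite_set[of "{0::nat}" "\<lambda>_. pmf \<pi> y"] by (auto dest: sums_unique2)
qed

section \<open>Growth of products of kernels\<close>

definition kernel_op :: "('e \<Rightarrow> 'e \<Rightarrow> real) \<Rightarrow> ('e::finite \<Rightarrow> real) \<Rightarrow> 'e \<Rightarrow> real" where
  "kernel_op B g = (\<lambda>x. \<Sum>y\<in>UNIV. B x y * g y)"

lemma derivative_at_right_approx:
  assumes "(F has_real_derivative D) (at 0)" "0 < \<delta>"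
  shows "\<forall>\<^sub>F h in at_right 0. \<bar>F h - F 0 - h * D\<bar> \<le> \<delta> * h"
proof -
  have "((\<lambda>h. (F h - F 0) / h) \<longlongrightarrow> D) (at 0)"
    using assms(1) by (simp add: has_field_derivative_iff)
  then have "((\<lambda>h. (F h - F 0) / h) \<longlongrightarrow> D) (at_right 0)"
    by (rule filterlim_mono) (auto simp: at_le)
  then have "\<forall>\<^sub>F h in at_right 0. dist ((F h - F 0) / h) D < \<delta>"
    using assms(2) by (rule tendstoD)
  moreover have "\<forall>\<^sub>F h in at_right (0::real). 0 < h"
    by (simp add: eventually_at_right_less)
  ultimately show ?thesis
  proof eventually_elim
    case (elim h)
    have "F h - F 0 - h * D = h * ((F h - F 0) / h - D)" using elim(2) by (simp add: field_simps)
    then have "\<bar>F h - F 0 - h * D\<bar> = h * \<bar>(F h - F 0) / h - D\<bar>" using elim(2) by (simp add: abs_mult)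
    also have "\<dots> \<le> h * \<delta>" using elim by (intro mult_left_mono) (auto simp: dist_real_def)
    finally show ?case by (simp add: mult.commute)
  qed
qed

text \<open>
  The squared norm of \<open>B h g\<close> is a quadratic form in \<open>g\<close> with coefficients \<open>K h y z\<close>. At \<open>h = 0\<close> it
  is the squared norm of \<open>g\<close>, and its derivative there is \<open>2 \<langle>G g, g\<rangle>\<close>. Only finitely many coefficients
  occur, so the first-order error is uniform in \<open>g\<close>.
\<close>
lemma (in full_support) kernel_growth:
  assumes B0: "\<And>x y. B 0 x y = (if x = y then 1 else 0)"
    and deriv: "\<And>x y. ((\<lambda>h. B h x y) has_real_derivative G x y) (at 0)"
    and form: "\<And>g. l2_inner \<pi> (kernel_op G g) g \<le> c * l2_inner \<pi> g g"
    and "0 < \<epsilon>"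
  shows "\<forall>\<^sub>F h in at_right 0. \<forall>g. l2_inner \<pi> (kernel_op (B h) g) (kernel_op (B h) g)
    \<le> exp (2 * h * (c + \<epsilon>)) * l2_inner \<pi> g g"
proof -
  define K where "K h y z = (\<Sum>x\<in>UNIV. pmf \<pi> x * (B h x y * B h x z))" for h y z
  define D where "D y z = pmf \<pi> z * G z y + pmf \<pi> y * G y z" for y z
  \<comment> \<open>\<open>C\<close> compares the square of the unweighted \<open>\<ell>\<^sup>1\<close> norm with the squared norm\<close>
  define w where "w = (\<lambda>x. 1 / pmf \<pi> x)"
  define C where "C = l2_inner \<pi> w w"
  have expand: "l2_inner \<pi> (kernel_op (B h) g) (kernel_op (B h) g)
      = (\<Sum>y\<in>UNIV. \<Sum>z\<in>UNIV. g y * g z * K h y z)" for h g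
  proof -
    have "l2_inner \<pi> (kernel_op (B h) g) (kernel_op (B h) g)
        = (\<Sum>x\<in>UNIV. \<Sum>y\<in>UNIV. \<Sum>z\<in>UNIV. g y * g z * (pmf \<pi> x * (B h x y * B h x z)))"
      unfolding l2_inner_def kernel_op_def sum_product unfolding sum_distrib_right
      by (simp add: mult_ac)
    also have "\<dots> = (\<Sum>y\<in>UNIV. \<Sum>x\<in>UNIV. \<Sum>z\<in>UNIV. g y * g z * (pmf \<pi> x * (B h x y * B h x z)))"
      by (rule sum.swap)
    also have "\<dots> = (\<Sum>y\<in>UNIV. \<Sum>z\<in>UNIV. \<Sum>x\<in>UNIV. g y * g z * (pmf \<pi> x * (B h x y * B h x z)))"
      by (intro sum.cong refl sum.swap)
    finally show ?thesis by (simp add: K_def sum_distrib_left)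
  qed
  have K0: "K 0 y z = (if y = z then pmf \<pi> y else 0)" for y z
  proof -
    have "K 0 y z = (\<Sum>x\<in>UNIV. if x = y then (if y = z then pmf \<pi> y else 0) else 0)"
      unfolding K_def by (intro sum.cong) (auto simp: B0)
    then show ?thesis by simp
  qed
  have KD: "((\<lambda>h. K h y z) has_real_derivative D y z) (at 0)" for y z
  proof -
    have "((\<lambda>h. K h y z) has_real_derivative
        (\<Sum>x\<in>UNIV. pmf \<pi> x * (G x y * B 0 x z + G x z * B 0 x y))) (at 0)"
      unfolding K_def by (intro DERIV_sum DERIV_cmult DERIV_mult deriv)
    moreover have "(\<Sum>x\<in>UNIV. pmf \<pi> x * (G x y * B 0 x z + G x z * B 0 x y))
        = (\<Sum>x\<in>UNIV. (if x = z then pmf \<pi> z * G z y else 0) + (if x = y then pmf \<pi> y * G y z else 0))"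
      by (intro sum.cong) (auto simp: B0 algebra_simps)
    ultimately show ?thesis by (simp add: D_def sum.distrib)
  qed
  have zero_form: "(\<Sum>y\<in>UNIV. \<Sum>z\<in>UNIV. g y * g z * K 0 y z) = l2_inner \<pi> g g" for g
    by (simp add: K0 l2_inner_def if_distrib sum.delta cong: if_cong)
  have D_form: "(\<Sum>y\<in>UNIV. \<Sum>z\<in>UNIV. g y * g z * D y z) = 2 * l2_inner \<pi> (kernel_op G g) g" for g
  proof -
    have "(\<Sum>y\<in>UNIV. \<Sum>z\<in>UNIV. g y * g z * D y z)
        = (\<Sum>y\<in>UNIV. \<Sum>z\<in>UNIV. G z y * g y * g z * pmf \<pi> z)
          + (\<Sum>y\<in>UNIV. \<Sum>z\<in>UNIV. G y z * g z * g y * pmf \<pi> y)"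
      unfolding sum.distrib[symmetric] by (intro sum.cong refl) (simp add: D_def algebra_simps)
    also have "(\<Sum>y\<in>UNIV. \<Sum>z\<in>UNIV. G z y * g y * g z * pmf \<pi> z)
        = (\<Sum>z\<in>UNIV. \<Sum>y\<in>UNIV. G z y * g y * g z * pmf \<pi> z)"
      by (rule sum.swap)
    finally show ?thesis by (simp add: l2_inner_def kernel_op_def sum_distrib_right)
  qed
  have "w \<noteq> (\<lambda>_. 0)" by (auto simp: w_def fun_eq_iff)
  then have C: "0 < C" unfolding C_def by (rule l2_inner_self_pos)
  have l1: "(\<Sum>y\<in>UNIV. \<Sum>z\<in>UNIV. \<bar>g y\<bar> * \<bar>g z\<bar>) \<le> C * l2_inner \<pi> g g" for g
  proof -
    have "(\<Sum>y\<in>UNIV. \<bar>g y\<bar>) = l2_inner \<pi> w (\<lambda>y. \<bar>g y\<bar>)"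
      by (simp add: l2_inner_def w_def)
    also have "\<dots> \<le> sqrt C * sqrt (l2_inner \<pi> g g)"
      using l2_cauchy_schwarz[of \<pi> w "\<lambda>y. \<bar>g y\<bar>"] by (simp add: C_def l2_norm_def) (simp add: l2_inner_def)
    finally have "(\<Sum>y\<in>UNIV. \<bar>g y\<bar>)\<^sup>2 \<le> (sqrt C * sqrt (l2_inner \<pi> g g))\<^sup>2"
      by (rule power_mono) (simp add: sum_nonneg)
    also have "\<dots> = C * l2_inner \<pi> g g"
      using C l2_inner_nonneg[of \<pi> g] by (simp add: power_mult_distrib)
    finally show ?thesis by (simp add: power2_eq_square sum_product)
  qed
  define \<delta> where "\<delta> = 2 * \<epsilon> / C"
  have "0 < \<delta>" using C \<open>0 < \<epsilon>\<close> by (simp add: \<delta>_def)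
  then have "\<forall>\<^sub>F h in at_right 0. \<forall>y\<in>UNIV. \<forall>z\<in>UNIV. \<bar>K h y z - K 0 y z - h * D y z\<bar> \<le> \<delta> * h"
    by (intro eventually_ball_finite ballI derivative_at_right_approx KD finite)
  moreover have "\<forall>\<^sub>F h in at_right (0::real). 0 < h"
    by (simp add: eventually_at_right_less)
  ultimately show ?thesis
  proof eventually_elim
    case (elim h)
    show ?case
    proof
      fix g
      have entry: "g y * g z * K h y z \<le> g y * g z * K 0 y z + h * (g y * g z * D y z) + \<delta> * h * (\<bar>g y\<bar> * \<bar>g z\<bar>)" for y z
      proof -
        have "g y * g z * (K h y z - K 0 y z - h * D y z) \<le> \<bar>g y * g z * (K h y z - K 0 y z - h * D y z)\<bar>"
          by simp
        also have "\<dots> = \<bar>g y\<bar> * \<bar>g z\<bar> * \<bar>K h y z - K 0 y z - h * D y z\<bar>" by (simp add: abs_mult)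
        also have "\<dots> \<le> \<bar>g y\<bar> * \<bar>g z\<bar> * (\<delta> * h)"
          using elim(1) by (intro mult_left_mono) auto
        finally show ?thesis by (simp add: algebra_simps)
      qed
      have "l2_inner \<pi> (kernel_op (B h) g) (kernel_op (B h) g)
          \<le> (\<Sum>y\<in>UNIV. \<Sum>z\<in>UNIV. g y * g z * K 0 y z + h * (g y * g z * D y z) + \<delta> * h * (\<bar>g y\<bar> * \<bar>g z\<bar>))"
        unfolding expand by (intro sum_mono entry)
      also have "\<dots> = l2_inner \<pi> g g + h * (2 * l2_inner \<pi> (kernel_op G g) g)
          + \<delta> * h * (\<Sum>y\<in>UNIV. \<Sum>z\<in>UNIV. \<bar>g y\<bar> * \<bar>g z\<bar>)"
        unfolding sum.distrib sum_distrib_left[symmetric] zero_form D_form ..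
      also have "\<dots> \<le> l2_inner \<pi> g g + h * (2 * (c * l2_inner \<pi> g g)) + \<delta> * h * (C * l2_inner \<pi> g g)"
        using elim(2) \<open>0 < \<delta>\<close> by (intro add_mono mult_left_mono form l1) auto
      also have "\<dots> = (1 + 2 * h * (c + \<epsilon>)) * l2_inner \<pi> g g"
        using C by (simp add: \<delta>_def field_simps)
      also have "\<dots> \<le> exp (2 * h * (c + \<epsilon>)) * l2_inner \<pi> g g"
        by (intro mult_right_mono exp_ge_add_one_self l2_inner_nonneg)
      finally show "l2_inner \<pi> (kernel_op (B h) g) (kernel_op (B h) g)
          \<le> exp (2 * h * (c + \<epsilon>)) * l2_inner \<pi> g g" .
    qed
  qed
qed

lemma l2_iterate_growth:
  assumes "\<And>g. l2_inner \<pi> (A g) (A g) \<le> q * l2_inner \<pi> g g" "0 \<le> q"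
  shows "l2_inner \<pi> ((A ^^ n) g) ((A ^^ n) g) \<le> q ^ n * l2_inner \<pi> g g"
proof (induction n)
  case (Suc n)
  have "l2_inner \<pi> ((A ^^ Suc n) g) ((A ^^ Suc n) g) \<le> q * l2_inner \<pi> ((A ^^ n) g) ((A ^^ n) g)"
    using assms(1) by simp
  also have "\<dots> \<le> q * (q ^ n * l2_inner \<pi> g g)"
    using Suc assms(2) by (rule mult_left_mono)
  finally show ?case by (simp add: mult_ac)
qed simp

section \<open>Exponential moments of additive functionals\<close>

context markov_jump_process
begin

abbreviation "p \<equiv> transition P X"

lemma space_P: "space (P x) = space M"
  using sets_P[of x] by (rule sets_eq_imp_space_eq)

lemma measurable_P_eq [simp]: "measurable (P x) = measurable M"
  by (intro ext measurable_cong_sets sets_P refl)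

lemma space_filtration: "space (natural_filtration M X s) = space M"
  unfolding natural_filtration_def by (intro space_measure_of) auto

lemma sets_filtration:
  "sets (natural_filtration M X s) = sigma_sets (space M) {X u -` B \<inter> space M |u B. 0 \<le> u \<and> u \<le> s}"
  unfolding natural_filtration_def by (intro sets_measure_of) auto

lemma X_measurable_filtration:
  assumes "0 \<le> u" "u \<le> s"
  shows "X u \<in> measurable (natural_filtration M X s) (count_space UNIV)"
proof (rule measurableI)
  fix B :: "'e set"
  show "X u -` B \<inter> space (natural_filtration M X s) \<in> sets (natural_filtration M X s)"
    unfolding space_filtration sets_filtration using assms by (intro sigma_sets.Basic) auto
qed simp

lemma subalgebra_filtration: "subalgebra (P x) (natural_filtration M X s)"
proof -
  let ?G = "{X u -` B \<inter> space M |u B. 0 \<le> u \<and> u \<le> s}"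
  have "?G \<subseteq> sets M"
    using measurable_X by (auto intro: measurable_sets)
  then have "sigma_sets (space M) ?G \<subseteq> sets M"
    by (rule sets.sigma_sets_subset)
  then show ?thesis
    unfolding subalgebra_def space_filtration sets_filtration sets_P space_P by simp
qed

lemma integrable_bounded:
  fixes Z :: "'w \<Rightarrow> real"
  assumes "Z \<in> borel_measurable M" "\<And>\<omega>. \<bar>Z \<omega>\<bar> \<le> C"
  shows "integrable (P x) Z"
proof -
  interpret prob_space "P x" by (rule prob_space_P)
  show ?thesis
    using assms by (intro integrable_const_bound[of _ C]) auto
qed

text \<open>
  The Markov property is stated for indicators of the events \<open>X (s + t) = y\<close>; as there are finitely many
  states, every function \<open>g\<close> is a combination of them.
\<close>
lemma markov_expectation:
  assumes Z: "Z \<in> borel_measurable (natural_filtration M X s)" "\<And>\<omega>. \<bar>Z \<omega>\<bar> \<le> C"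
    and st: "0 \<le> s" "0 \<le> t"
  shows "(\<integral>\<omega>. Z \<omega> * g (X (s + t) \<omega>) \<partial>P x) = (\<integral>\<omega>. Z \<omega> * kernel_op (\<lambda>x y. p x y t) g (X s \<omega>) \<partial>P x)"
proof -
  interpret prob_space "P x" by (rule prob_space_P)
  interpret finite_measure_subalgebra "P x" "natural_filtration M X s"
    by unfold_locales (rule subalgebra_filtration)
  have [measurable]: "Z \<in> borel_measurable M"
    using measurable_from_subalg[OF subalgebra_filtration Z(1), of x] by simp
  have [measurable]: "X s \<in> measurable M (count_space UNIV)" "X (s + t) \<in> measurable M (count_space UNIV)"
    using st by (auto intro: measurable_X)
  let ?I = "\<lambda>y. indicator {\<omega>' \<in> space M. X (s + t) \<omega>' = y} :: 'w \<Rightarrow> real"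
  have meas_I [measurable]: "?I y \<in> borel_measurable M" for y
    by measurable
  have bound_I: "\<bar>Z \<omega> * ?I y \<omega>\<bar> \<le> C" for y \<omega>
    using Z(2)[of \<omega>] order_trans[OF abs_ge_zero Z(2)[of \<omega>]] by (auto simp: indicator_def)
  have int_I: "integrable (P x) (\<lambda>\<omega>. Z \<omega> * ?I y \<omega>)" for y
    using bound_I by (intro integrable_bounded[where C = C]) auto
  have p_bound: "\<bar>p z y t\<bar> \<le> 1" for z y
  proof -
    interpret z: prob_space "P z" by (rule prob_space_P)
    show ?thesis by (simp add: transition_def)
  qed
  have int_p: "integrable (P x) (\<lambda>\<omega>. Z \<omega> * p (X s \<omega>) y t)" for y
  proof (rule integrable_bounded[where C = "C * 1"])
    show "\<bar>Z \<omega> * p (X s \<omega>) y t\<bar> \<le> C * 1" for \<omega>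
      unfolding abs_mult using Z(2)[of \<omega>] p_bound by (intro mult_mono) (auto intro: order_trans)
  qed measurable
  have one: "(\<integral>\<omega>. Z \<omega> * ?I y \<omega> \<partial>P x) = (\<integral>\<omega>. Z \<omega> * p (X s \<omega>) y t \<partial>P x)" for y
  proof -
    have "(\<integral>\<omega>. Z \<omega> * ?I y \<omega> \<partial>P x)
        = (\<integral>\<omega>. Z \<omega> * real_cond_exp (P x) (natural_filtration M X s) (?I y) \<omega> \<partial>P x)"
      using int_I Z(1) meas_I[of y] by (intro real_cond_exp_intg(2)[symmetric]) auto
    also have "\<dots> = (\<integral>\<omega>. Z \<omega> * p (X s \<omega>) y t \<partial>P x)"
    proof (rule integral_cong_AE)
      have "real_cond_exp (P x) (natural_filtration M X s) (?I y) \<in> borel_measurable (P x)"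
        by (rule borel_measurable_cond_exp2)
      then show "(\<lambda>\<omega>. Z \<omega> * real_cond_exp (P x) (natural_filtration M X s) (?I y) \<omega>)
          \<in> borel_measurable (P x)" by simp
      show "AE \<omega> in P x. Z \<omega> * real_cond_exp (P x) (natural_filtration M X s) (?I y) \<omega>
          = Z \<omega> * p (X s \<omega>) y t"
        using markov[OF st, of x y] by eventually_elim simp
    qed simp
    finally show ?thesis .
  qed
  have "(\<integral>\<omega>. Z \<omega> * g (X (s + t) \<omega>) \<partial>P x) = (\<integral>\<omega>. (\<Sum>y\<in>UNIV. g y * (Z \<omega> * ?I y \<omega>)) \<partial>P x)"
  proof (rule Bochner_Integration.integral_cong[OF refl])
    fix \<omega> assume "\<omega> \<in> space (P x)"
    then have "\<omega> \<in> space M" by (simp add: space_P)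
    then have "(\<Sum>y\<in>UNIV. g y * (Z \<omega> * ?I y \<omega>)) = (\<Sum>y\<in>UNIV. if X (s + t) \<omega> = y then g y * Z \<omega> else 0)"
      by (intro sum.cong) auto
    then show "Z \<omega> * g (X (s + t) \<omega>) = (\<Sum>y\<in>UNIV. g y * (Z \<omega> * ?I y \<omega>))" by simp
  qed
  also have "\<dots> = (\<Sum>y\<in>UNIV. g y * (\<integral>\<omega>. Z \<omega> * ?I y \<omega> \<partial>P x))"
    using int_I by (simp add: Bochner_Integration.integral_sum)
  also have "\<dots> = (\<Sum>y\<in>UNIV. g y * (\<integral>\<omega>. Z \<omega> * p (X s \<omega>) y t \<partial>P x))"
    by (simp only: one)
  also have "\<dots> = (\<integral>\<omega>. (\<Sum>y\<in>UNIV. g y * (Z \<omega> * p (X s \<omega>) y t)) \<partial>P x)"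
    using int_p by (simp add: Bochner_Integration.integral_sum)
  also have "\<dots> = (\<integral>\<omega>. Z \<omega> * kernel_op (\<lambda>x y. p x y t) g (X s \<omega>) \<partial>P x)"
    by (simp add: kernel_op_def sum_distrib_left mult_ac)
  finally show ?thesis .
qed

text \<open>
  Conditioning on the time \<open>n h\<close> turns what happens in the next step into one application of the kernel
  to \<open>g\<close>. The factors start at \<open>k = 1\<close>, since the weights are attached to the end of each step.
\<close>
lemma skeleton_moment:
  assumes "0 \<le> h"
  shows "(\<integral>\<omega>. (\<Prod>k=1..n. w (X (real k * h) \<omega>)) * g (X (real n * h) \<omega>) \<partial>P x)
    = (kernel_op (\<lambda>x y. p x y h * w y) ^^ n) g x"
proof (induction n arbitrary: g)
  case 0
  interpret prob_space "P x" by (rule prob_space_P)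
  have [measurable]: "X 0 \<in> measurable M (count_space UNIV)" by (auto intro: measurable_X)
  have "AE \<omega> in P x. \<omega> \<in> {\<omega> \<in> space M. X 0 \<omega> = x}"
    using start[of x] by (subst AE_in_set_eq_1) (auto simp: sets_P)
  then have "(\<integral>\<omega>. g (X 0 \<omega>) \<partial>P x) = (\<integral>\<omega>. g x \<partial>P x)"
    by (intro integral_cong_AE) auto
  then show ?case by (simp add: prob_space)
next
  case (Suc n)
  define Z where "Z \<omega> = (\<Prod>k=1..n. w (X (real k * h) \<omega>))" for \<omega>
  define W where "W = (\<Sum>y\<in>UNIV. \<bar>w y\<bar>)"
  have W: "\<bar>w y\<bar> \<le> W" for y
    unfolding W_def by (intro member_le_sum) auto
  have "Z \<in> borel_measurable (natural_filtration M X (real n * h))"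
    unfolding Z_def
  proof (intro borel_measurable_prod)
    fix k assume "k \<in> {1..n}"
    then have "X (real k * h) \<in> measurable (natural_filtration M X (real n * h)) (count_space UNIV)"
      using assms by (intro X_measurable_filtration) (auto intro!: mult_right_mono)
    then show "(\<lambda>\<omega>. w (X (real k * h) \<omega>)) \<in> borel_measurable (natural_filtration M X (real n * h))"
      by (rule measurable_compose) simp
  qed
  moreover have "\<bar>Z \<omega>\<bar> \<le> (\<Prod>k=1..n. W)" for \<omega>
    unfolding Z_def abs_prod using W by (intro prod_mono) auto
  ultimately have step: "(\<integral>\<omega>. Z \<omega> * g' (X (real n * h + h) \<omega>) \<partial>P x)
      = (\<integral>\<omega>. Z \<omega> * kernel_op (\<lambda>x y. p x y h) g' (X (real n * h) \<omega>) \<partial>P x)" for g'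
    using assms by (intro markov_expectation) auto
  have "(\<integral>\<omega>. (\<Prod>k=1..Suc n. w (X (real k * h) \<omega>)) * g (X (real (Suc n) * h) \<omega>) \<partial>P x)
      = (\<integral>\<omega>. Z \<omega> * (\<lambda>y. w y * g y) (X (real n * h + h) \<omega>) \<partial>P x)"
    by (simp add: Z_def algebra_simps)
  also have "\<dots> = (\<integral>\<omega>. Z \<omega> * kernel_op (\<lambda>x y. p x y h) (\<lambda>y. w y * g y) (X (real n * h) \<omega>) \<partial>P x)"
    by (rule step)
  also have "kernel_op (\<lambda>x y. p x y h) (\<lambda>y. w y * g y) = kernel_op (\<lambda>x y. p x y h * w y) g"
    by (simp add: kernel_op_def mult_ac)
  also have "(\<integral>\<omega>. Z \<omega> * kernel_op (\<lambda>x y. p x y h * w y) g (X (real n * h) \<omega>) \<partial>P x)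
      = (kernel_op (\<lambda>x y. p x y h * w y) ^^ n) (kernel_op (\<lambda>x y. p x y h * w y) g) x"
    unfolding Z_def by (rule Suc.IH)
  finally show ?case by (simp only: funpow_Suc_right comp_apply)
qed

definition riemann_sum :: "('e \<Rightarrow> real) \<Rightarrow> real \<Rightarrow> nat \<Rightarrow> 'w \<Rightarrow> real" where
  "riemann_sum f t n \<omega> = (\<Sum>k=1..n. f (X (real k * (t / real n)) \<omega>)) * (t / real n)"

text \<open>
  The sum is the integral of the step function \<open>\<phi> n\<close> that at time \<open>s\<close> looks at the path at the next
  grid point. These grid points are at least \<open>s\<close> and converge to \<open>s\<close>, and the path is constant for
  a while after \<open>s\<close>, so \<open>\<phi> n s\<close> is eventually equal to \<open>f (X s)\<close>; dominated convergence applies.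
\<close>
lemma riemann_sum_tendsto:
  assumes \<omega>: "\<omega> \<in> space M" and t: "0 < t"
  shows "(\<lambda>n. riemann_sum f t (Suc n) \<omega>) \<longlonglongrightarrow> additive_functional X f t \<omega>"
proof -
  define h where "h n = t / real (Suc n)" for n
  have h: "0 < h n" for n using t by (simp add: h_def)
  have Nh: "real (Suc n) * h n = t" for n by (simp add: h_def)
  \<comment> \<open>The null set \<open>{0}\<close> belongs to no cell; its own term makes the convergence hold everywhere,
      which also yields measurability of the limit.\<close>
  define \<phi> where "\<phi> n s = f (X 0 \<omega>) * indicator {0} s
    + (\<Sum>k=1..Suc n. f (X (real k * h n) \<omega>) * indicator {(real k - 1) * h n<..real k * h n} s)" for n s
  define \<psi> where "\<psi> s = indicator {0..t} s * f (X s \<omega>)" for s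
  have inside: "\<phi> n s = f (X (real_of_int \<lceil>s / h n\<rceil> * h n) \<omega>)" if "0 < s" "s \<le> t" for n s
  proof -
    define j where "j = nat \<lceil>s / h n\<rceil>"
    have j_pos: "0 < \<lceil>s / h n\<rceil>" using that h[of n] by simp
    then have j: "real j = real_of_int \<lceil>s / h n\<rceil>" by (simp add: j_def)
    have "s / h n \<le> real (Suc n)" using that h[of n] Nh[of n] by (simp add: divide_le_eq)
    then have "j \<le> Suc n" by (simp add: j_def ceiling_le_iff)
    moreover have "1 \<le> j" using j_pos unfolding j_def by linarith
    moreover have ind: "indicator {(real k - 1) * h n<..real k * h n} s = (if k = j then 1 else 0 :: real)" for k
    proof -
      have "s \<in> {(real k - 1) * h n<..real k * h n} \<longleftrightarrow> real k - 1 < s / h n \<and> s / h n \<le> real k"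
        using h[of n] by (simp add: less_divide_eq divide_le_eq)
      also have "\<dots> \<longleftrightarrow> \<lceil>s / h n\<rceil> = int k" 
        by (auto simp: ceiling_eq_iff)
      also have "\<dots> \<longleftrightarrow> k = j" using j_pos by (auto simp: j_def)
      finally show ?thesis by (simp add: indicator_def)
    qed
    ultimately have "\<phi> n s = (\<Sum>k=1..Suc n. if k = j then f (X (real k * h n) \<omega>) else 0)"
      unfolding \<phi>_def ind using that(1) by (simp add: if_distrib cong: if_cong)
    also have "\<dots> = f (X (real j * h n) \<omega>)" using \<open>1 \<le> j\<close> \<open>j \<le> Suc n\<close> by (simp add: sum.delta)
    finally show ?thesis by (simp add: j)
  qed
  have outside: "\<phi> n s = 0" if "s < 0 \<or> t < s" for n s
  proof -
    have "indicator {(real k - 1) * h n<..real k * h n} s = (0::real)" if k: "k \<in> {1..Suc n}" for k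
    proof -
      have "0 \<le> (real k - 1) * h n" using k h[of n] by (intro mult_nonneg_nonneg) auto
      moreover have "real k * h n \<le> t"
        unfolding Nh[of n, symmetric] using k h[of n] by (intro mult_right_mono) auto
      ultimately show ?thesis using \<open>s < 0 \<or> t < s\<close> by (auto simp: indicator_def)
    qed
    then show ?thesis using that t by (auto simp: \<phi>_def)
  qed
  have at0: "\<phi> n 0 = f (X 0 \<omega>)" for n
  proof -
    have "indicator {(real k - 1) * h n<..real k * h n} 0 = (0::real)" if k: "k \<in> {1..Suc n}" for k
    proof -
      have "0 \<le> (real k - 1) * h n" using k h[of n] by (intro mult_nonneg_nonneg) auto
      then show ?thesis by (auto simp: indicator_def)
    qed
    then show ?thesis by (auto simp: \<phi>_def)
  qed
  have lim: "(\<lambda>n. \<phi> n s) \<longlonglongrightarrow> \<psi> s" for s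
  proof (cases "0 < s \<and> s \<le> t")
    case True
    define a where "a n = real_of_int \<lceil>s / h n\<rceil> * h n" for n
    have ge: "s \<le> a n" for n
    proof -
      have "s = s / h n * h n" using h[of n] by simp
      also have "\<dots> \<le> a n" unfolding a_def using h[of n] by (intro mult_right_mono) auto
      finally show ?thesis .
    qed
    have le: "a n \<le> s + h n" for n
    proof -
      have "a n \<le> (s / h n + 1) * h n"
        unfolding a_def using h[of n] of_int_ceiling_le_add_one[of "s / h n"] by (intro mult_right_mono) auto
      also have "\<dots> = s + h n" using h[of n] by (simp add: field_simps)
      finally show ?thesis .
    qed
    have "h \<longlonglongrightarrow> 0" unfolding h_def by (rule lim_const_over_n[THEN LIMSEQ_Suc])
    then have "(\<lambda>n. s + h n) \<longlonglongrightarrow> s" using tendsto_add[OF tendsto_const[of s]] by fastforce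
    then have lim_a: "a \<longlonglongrightarrow> s"
      using ge le by (intro tendsto_sandwich[of "\<lambda>_. s" a sequentially "\<lambda>n. s + h n"]) auto
    have "\<forall>\<^sub>F v in at_right s. X v \<omega> = X s \<omega>"
      using right_continuous[OF \<omega>, of s] True by simp
    then obtain b where b: "s < b" "\<And>v. s < v \<Longrightarrow> v < b \<Longrightarrow> X v \<omega> = X s \<omega>"
      using eventually_at_right[of s "s + 1"] by auto
    have "\<forall>\<^sub>F n in sequentially. a n < b"
      using lim_a b(1) by (rule order_tendstoD)
    then have "\<forall>\<^sub>F n in sequentially. \<phi> n s = \<psi> s"
    proof eventually_elim
      case (elim n)
      have "X (a n) \<omega> = X s \<omega>" using b(2)[of "a n"] elim ge[of n] by (cases "a n = s") auto
      then show ?case using inside[of s n] True by (simp add: \<psi>_def a_def)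
    qed
    then show ?thesis by (rule tendsto_eventually)
  next
    case False
    then have "\<phi> n s = \<psi> s" for n
      using outside[of s n] at0[of n] t by (cases "s = 0") (auto simp: \<psi>_def)
    then show ?thesis by simp
  qed
  define F where "F = (\<Sum>y\<in>UNIV. \<bar>f y\<bar>)"
  have F: "\<bar>f y\<bar> \<le> F" for y unfolding F_def by (intro member_le_sum) auto
  have bound: "\<bar>\<phi> n s\<bar> \<le> F * indicator {0..t} s" for n s
    using inside[of s n] outside[of s n] at0[of n] F by (cases "s = 0") (auto simp: indicator_def not_le)
  have [measurable]: "\<phi> n \<in> borel_measurable lborel" for n
    unfolding \<phi>_def by measurable
  have "\<psi> \<in> borel_measurable lborel"
    by (rule borel_measurable_LIMSEQ_real[of lborel \<phi>]) (rule lim, measurable)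
  then have "(\<lambda>n. integral\<^sup>L lborel (\<phi> n)) \<longlonglongrightarrow> integral\<^sup>L lborel \<psi>"
  proof (rule integral_dominated_convergence[where w = "\<lambda>s. F * indicator {0..t} s"])
    show "integrable lborel (\<lambda>s. F * indicator {0..t} s)"
      using t by (intro integrable_mult_right integrable_real_indicator) auto
  qed (use lim bound in auto)
  moreover have "integral\<^sup>L lborel (\<phi> n) = riemann_sum f t (Suc n) \<omega>" for n
  proof -
    have le: "(real k - 1) * h n \<le> real k * h n" for k using h[of n] by simp
    have int: "integrable lborel (\<lambda>s. f (X (real k * h n) \<omega>) * indicator {(real k - 1) * h n<..real k * h n} s)" for k
      using le[of k] by (intro integrable_mult_right integrable_real_indicator) auto
    have cell: "(\<integral>s. f (X (real k * h n) \<omega>) * indicator {(real k - 1) * h n<..real k * h n} s \<partial>lborel)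
        = f (X (real k * h n) \<omega>) * (real k * h n - (real k - 1) * h n)" for k
      using le[of k] by simp
    have int0: "integrable lborel (\<lambda>s. f (X 0 \<omega>) * indicator {0} s)"
      by (intro integrable_mult_right integrable_real_indicator) auto
    have "integral\<^sup>L lborel (\<phi> n)
      = (\<Sum>k=1..Suc n. f (X (real k * h n) \<omega>) * (real k * h n - (real k - 1) * h n))"
      unfolding \<phi>_def
      by (subst Bochner_Integration.integral_add[OF int0 Bochner_Integration.integrable_sum[OF int]],
          subst Bochner_Integration.integral_sum[OF int]) (simp only: cell, simp)
    also have "\<dots> = riemann_sum f t (Suc n) \<omega>"
      unfolding riemann_sum_def h_def[symmetric] sum_distrib_right
      by (intro sum.cong refl) (simp add: algebra_simps)
    finally show ?thesis .
  qed
  moreover have "integral\<^sup>L lborel \<psi> = additive_functional X f t \<omega>"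
    by (simp add: additive_functional_def set_lebesgue_integral_def \<psi>_def[abs_def])
  ultimately show ?thesis by simp
qed

lemma riemann_sum_measurable:
  assumes "0 < t"
  shows "riemann_sum f t n \<in> borel_measurable M"
proof -
  have "(\<lambda>\<omega>. f (X (real k * (t / real n)) \<omega>)) \<in> borel_measurable M" for k
    using assms by (intro measurable_compose[OF measurable_X]) auto
  then show ?thesis unfolding riemann_sum_def[abs_def] by measurable
qed

lemma riemann_sum_bound:
  assumes "0 < t"
  shows "\<bar>riemann_sum f t (Suc n) \<omega>\<bar> \<le> t * (\<Sum>y\<in>UNIV. \<bar>f y\<bar>)"
proof -
  define F where "F = (\<Sum>y\<in>UNIV. \<bar>f y\<bar>)"
  have F: "\<bar>f y\<bar> \<le> F" for y unfolding F_def by (intro member_le_sum) auto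
  have "\<bar>\<Sum>k=1..Suc n. f (X (real k * (t / real (Suc n))) \<omega>)\<bar> \<le> (\<Sum>k=1..Suc n. F)"
    by (rule order_trans[OF sum_abs sum_mono]) (rule F)
  then have "\<bar>riemann_sum f t (Suc n) \<omega>\<bar> \<le> (\<Sum>k=1..Suc n. F) * (t / real (Suc n))"
    unfolding riemann_sum_def abs_mult using assms by (intro mult_mono) auto
  also have "\<dots> = t * F" by (simp add: field_simps)
  finally show ?thesis by (simp add: F_def)
qed

lemma additive_functional_measurable:
  assumes "0 < t"
  shows "additive_functional X f t \<in> borel_measurable M"
proof (rule borel_measurable_LIMSEQ_real)
  show "(\<lambda>n. riemann_sum f t (Suc n) \<omega>) \<longlonglongrightarrow> additive_functional X f t \<omega>"
    if "\<omega> \<in> space M" for \<omega>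
    using that assms by (rule riemann_sum_tendsto)
qed (rule riemann_sum_measurable[OF assms])

lemma additive_functional_bound:
  assumes "\<omega> \<in> space M" "0 < t"
  shows "\<bar>additive_functional X f t \<omega>\<bar> \<le> t * (\<Sum>y\<in>UNIV. \<bar>f y\<bar>)"
  using LIMSEQ_le_const2[OF tendsto_rabs[OF riemann_sum_tendsto[OF assms]]]
    riemann_sum_bound[OF assms(2)] by blast

lemma exp_moment_tendsto:
  assumes t: "0 < t"
  shows "(\<lambda>n. (kernel_op (\<lambda>x y. p x y (t / real (Suc n)) * exp (t / real (Suc n) * r * f y)) ^^ Suc n) (\<lambda>_. 1) x)
    \<longlonglongrightarrow> (\<integral>\<omega>. exp (r * additive_functional X f t \<omega>) \<partial>P x)"
proof -
  interpret prob_space "P x" by (rule prob_space_P)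
  have "(\<lambda>n. \<integral>\<omega>. exp (r * riemann_sum f t (Suc n) \<omega>) \<partial>P x)
      \<longlonglongrightarrow> (\<integral>\<omega>. exp (r * additive_functional X f t \<omega>) \<partial>P x)"
  proof (rule integral_dominated_convergence[where w = "\<lambda>_. exp (\<bar>r\<bar> * (t * (\<Sum>y\<in>UNIV. \<bar>f y\<bar>)))"])
    show "AE \<omega> in P x. (\<lambda>n. exp (r * riemann_sum f t (Suc n) \<omega>)) \<longlonglongrightarrow> exp (r * additive_functional X f t \<omega>)"
      by (rule AE_I2) (auto intro!: tendsto_intros riemann_sum_tendsto t simp: space_P)
    show "AE \<omega> in P x. norm (exp (r * riemann_sum f t (Suc n) \<omega>)) \<le> exp (\<bar>r\<bar> * (t * (\<Sum>y\<in>UNIV. \<bar>f y\<bar>)))" for n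
    proof (rule AE_I2)
      fix \<omega>
      have "r * riemann_sum f t (Suc n) \<omega> \<le> \<bar>r\<bar> * \<bar>riemann_sum f t (Suc n) \<omega>\<bar>"
        by (metis abs_ge_self abs_mult)
      also have "\<dots> \<le> \<bar>r\<bar> * (t * (\<Sum>y\<in>UNIV. \<bar>f y\<bar>))"
        by (intro mult_left_mono riemann_sum_bound t) auto
      finally show "norm (exp (r * riemann_sum f t (Suc n) \<omega>)) \<le> exp (\<bar>r\<bar> * (t * (\<Sum>y\<in>UNIV. \<bar>f y\<bar>)))" by simp
    qed
  qed (use additive_functional_measurable[OF t, of f] riemann_sum_measurable[OF t, of f] in auto)
  moreover have "(\<integral>\<omega>. exp (r * riemann_sum f t (Suc n) \<omega>) \<partial>P x)
      = (kernel_op (\<lambda>x y. p x y (t / real (Suc n)) * exp (t / real (Suc n) * r * f y)) ^^ Suc n) (\<lambda>_. 1) x" for n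
  proof -
    let ?h = "t / real (Suc n)"
    have "exp (r * riemann_sum f t (Suc n) \<omega>) = (\<Prod>k=1..Suc n. exp (?h * r * f (X (real k * ?h) \<omega>))) * 1" for \<omega>
    proof -
      have "r * riemann_sum f t (Suc n) \<omega> = (\<Sum>k=1..Suc n. ?h * r * f (X (real k * ?h) \<omega>))"
        unfolding riemann_sum_def sum_distrib_left sum_distrib_right
        by (intro sum.cong refl) (simp only: mult_ac)
      then show ?thesis by (simp only: exp_sum[OF finite_atLeastAtMost] mult_1_right)
    qed
    then show ?thesis
      using skeleton_moment[where h = ?h and w = "\<lambda>y. exp (?h * r * f y)" and n = "Suc n" and g = "\<lambda>_. 1" and x = x] t by (simp only:) simp
  qed
  ultimately show ?thesis by simp
qed

lemma chernoff:
  assumes "0 < t" "0 \<le> r"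
  shows "measure (P x) {\<omega> \<in> space M. u \<le> additive_functional X f t \<omega> / t}
    \<le> exp (- (r * u * t)) * (\<integral>\<omega>. exp (r * additive_functional X f t \<omega>) \<partial>P x)"
proof -
  interpret prob_space "P x" by (rule prob_space_P)
  note [measurable] = additive_functional_measurable[OF assms(1), of f]
  let ?Y = "\<lambda>\<omega>. exp (r * additive_functional X f t \<omega>)"
  have int: "integrable (P x) ?Y"
  proof (rule integrable_const_bound[of _ "exp (r * (t * (\<Sum>y\<in>UNIV. \<bar>f y\<bar>)))"])
    show "AE \<omega> in P x. norm (?Y \<omega>) \<le> exp (r * (t * (\<Sum>y\<in>UNIV. \<bar>f y\<bar>)))"
    proof (rule AE_I2)
      fix \<omega> assume "\<omega> \<in> space (P x)"
      then have "additive_functional X f t \<omega> \<le> t * (\<Sum>y\<in>UNIV. \<bar>f y\<bar>)"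
        using additive_functional_bound[OF _ assms(1), of \<omega> f] by (simp add: space_P)
      then show "norm (?Y \<omega>) \<le> exp (r * (t * (\<Sum>y\<in>UNIV. \<bar>f y\<bar>)))"
        using assms(2) by (simp add: mult_left_mono)
    qed
  qed simp
  have "{\<omega> \<in> space M. u \<le> additive_functional X f t \<omega> / t} \<subseteq> {\<omega> \<in> space (P x). exp (r * u * t) \<le> ?Y \<omega>}"
    using assms mult_left_mono[OF _ assms(2)] by (auto simp: space_P pos_le_divide_eq mult.assoc)
  moreover have "{\<omega> \<in> space (P x). exp (r * u * t) \<le> ?Y \<omega>} \<in> sets (P x)"
    unfolding space_P sets_P by measurable
  ultimately have "measure (P x) {\<omega> \<in> space M. u \<le> additive_functional X f t \<omega> / t}
      \<le> measure (P x) {\<omega> \<in> space (P x). exp (r * u * t) \<le> ?Y \<omega>}"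
    by (rule finite_measure_mono)
  also have "\<dots> \<le> (\<integral>\<omega>. ?Y \<omega> \<partial>P x) / exp (r * u * t)"
    by (rule integral_Markov_inequality_measure[OF int, of "{}"]) auto
  finally show ?thesis by (simp add: exp_minus field_simps)
qed

end

lemma le_of_le_scaled_exp:
  fixes L N t c :: real
  assumes "\<And>\<epsilon>. 0 < \<epsilon> \<Longrightarrow> L \<le> N * exp (t * (c + \<epsilon>))"
  shows "L \<le> N * exp (t * c)"
proof -
  have "((\<lambda>\<epsilon>. N * exp (t * (c + \<epsilon>))) \<longlongrightarrow> N * exp (t * (c + 0))) (at_right 0)"
    by (intro tendsto_intros)
  moreover have "\<forall>\<^sub>F \<epsilon> in at_right 0. L \<le> N * exp (t * (c + \<epsilon>))"
    using assms by (auto intro: eventually_mono[OF eventually_at_right_less])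
  ultimately show ?thesis
    using tendsto_lowerbound[OF _ _ trivial_limit_at_right_real] by fastforce
qed

text \<open>
  The initial law enters only by Cauchy-Schwarz, as a pairing of its density with the iterates of the
  kernel applied to \<open>1\<close>.
\<close>
lemma (in markov_jump_process) exp_moment_bound:
  assumes "full_support \<pi>" and Q: "is_generator_matrix P X Q"
    and form: "\<And>g. l2_inner \<pi> (generator Q g) g + r * l2_inner \<pi> (\<lambda>x. f x * g x) g \<le> c * l2_inner \<pi> g g"
    and t: "0 < t"
  shows "(\<Sum>x\<in>UNIV. pmf \<nu> x * (\<integral>\<omega>. exp (r * additive_functional X f t \<omega>) \<partial>P x))
    \<le> l2_norm \<pi> (rel_density \<nu> \<pi>) * exp (t * c)"
proof -
  interpret full_support \<pi> by fact
  define B where "B h x y = matrix_exp (h *\<^sub>R Q) $ x $ y * exp (h * r * f y)" for h x y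
  define G where "G x y = Q $ x $ y + (if x = y then r * f y else 0)" for x y
  have B0: "B 0 x y = (if x = y then 1 else 0)" for x y
    using matrix_exp_0[of Q x y] by (simp add: B_def)
  have BG: "((\<lambda>h. B h x y) has_real_derivative G x y) (at 0)" for x y
    unfolding B_def
    by (rule DERIV_cong[OF DERIV_mult[OF matrix_exp_deriv_0]], rule DERIV_fun_exp, (rule derivative_intros)+)
      (use matrix_exp_0[of Q x y] in \<open>simp add: G_def\<close>)
  have "kernel_op G g = (\<lambda>x. generator Q g x + r * (f x * g x))" for g
    unfolding kernel_op_def generator_def G_def
    by (simp add: distrib_right sum.distrib if_distrib[of "\<lambda>z. z * _"] mult.assoc cong: if_cong)
  then have G_form: "l2_inner \<pi> (kernel_op G g) g \<le> c * l2_inner \<pi> g g" for g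
    using form[of g] by (simp add: l2_inner_simps)
  define v where "v n = (kernel_op (B (t / real (Suc n))) ^^ Suc n) (\<lambda>_. 1)" for n
  define N where "N = l2_norm \<pi> (rel_density \<nu> \<pi>)"
  have lim: "(\<lambda>n. \<Sum>x\<in>UNIV. pmf \<nu> x * v n x)
      \<longlonglongrightarrow> (\<Sum>x\<in>UNIV. pmf \<nu> x * (\<integral>\<omega>. exp (r * additive_functional X f t \<omega>) \<partial>P x))"
  proof (intro tendsto_intros)
    fix x
    have "p x y (t / real (Suc n)) * exp (t / real (Suc n) * r * f y) = B (t / real (Suc n)) x y" for x y n
      using Q t by (simp add: is_generator_matrix_def B_def)
    then show "(\<lambda>n. v n x) \<longlonglongrightarrow> (\<integral>\<omega>. exp (r * additive_functional X f t \<omega>) \<partial>P x)"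
      using exp_moment_tendsto[OF t, of r f x] unfolding v_def by (simp only:)
  qed
  show ?thesis
    unfolding N_def[symmetric]
  proof (rule le_of_le_scaled_exp)
    fix \<epsilon> :: real assume "0 < \<epsilon>"
    have "(\<lambda>n. t / real (Suc n)) \<longlonglongrightarrow> 0"
      by (rule lim_const_over_n[THEN LIMSEQ_Suc])
    then have "filterlim (\<lambda>n. t / real (Suc n)) (at_right 0) sequentially"
      using t by (intro tendsto_imp_filterlim_at_right) auto
    then have "\<forall>\<^sub>F n in sequentially. \<forall>g. l2_inner \<pi> (kernel_op (B (t / real (Suc n))) g) (kernel_op (B (t / real (Suc n))) g)
        \<le> exp (2 * (t / real (Suc n)) * (c + \<epsilon>)) * l2_inner \<pi> g g"
      using kernel_growth[where B = B and G = G, OF B0 BG G_form \<open>0 < \<epsilon>\<close>] by (rule eventually_compose_filterlim[rotated])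
    then have "\<forall>\<^sub>F n in sequentially. (\<Sum>x\<in>UNIV. pmf \<nu> x * v n x) \<le> N * exp (t * (c + \<epsilon>))"
    proof eventually_elim
      case (elim n)
      have "l2_inner \<pi> (v n) (v n)
          \<le> exp (2 * (t / real (Suc n)) * (c + \<epsilon>)) ^ Suc n * l2_inner \<pi> (\<lambda>_. 1) (\<lambda>_. 1)"
        unfolding v_def by (rule l2_iterate_growth) (use elim in auto)
      also have "\<dots> = exp (real (Suc n) * (2 * (t / real (Suc n)) * (c + \<epsilon>)))"
        by (simp only: exp_of_nat_mult l2_inner_one_one mult_1_right)
      also have "real (Suc n) * (2 * (t / real (Suc n)) * (c + \<epsilon>)) = 2 * (t * (c + \<epsilon>))"
        by (simp add: field_simps)
      also have "exp (2 * (t * (c + \<epsilon>))) = (exp (t * (c + \<epsilon>)))\<^sup>2"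
        by (rule exp_double)
      finally have norm: "l2_norm \<pi> (v n) \<le> exp (t * (c + \<epsilon>))"
        unfolding l2_norm_def by (rule real_le_lsqrt[rotated 1]) simp
      have "(\<Sum>x\<in>UNIV. pmf \<nu> x * v n x) = l2_inner \<pi> (rel_density \<nu> \<pi>) (v n)"
        by (simp add: l2_inner_def rel_density_def)
      also have "\<dots> \<le> N * l2_norm \<pi> (v n)"
        unfolding N_def by (rule l2_cauchy_schwarz)
      also have "\<dots> \<le> N * exp (t * (c + \<epsilon>))"
        using norm by (rule mult_left_mono) (simp add: N_def l2_norm_def l2_inner_nonneg)
      finally show ?case .
    qed
    then show "(\<Sum>x\<in>UNIV. pmf \<nu> x * (\<integral>\<omega>. exp (r * additive_functional X f t \<omega>) \<partial>P x))
        \<le> N * exp (t * (c + \<epsilon>))"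
      using lim by (intro tendsto_upperbound[OF lim]) auto
  qed
qed


section \<open>The deviation inequality\<close>

text \<open>
  The matrix \<open>p(1) = exp Q\<close> is stochastic with positive entries. It leaves \<open>\<pi>\<close> invariant, so \<open>\<pi>\<close> has full
  support, and it fixes every harmonic function; averaging at a point where the function is
  maximal shows that the function is constant.
\<close>
lemma irreducible_imp_ergodic_generator:
  fixes P :: "'e::finite \<Rightarrow> 'w measure"
  assumes "2 \<le> CARD('e)" and irr: "irreducible_process P X" and Q: "is_generator_matrix P X Q"
    and inv: "invariant_distribution Q \<pi>"
  shows "ergodic_generator \<pi> Q"
proof
  have p: "0 < matrix_exp (1 *\<^sub>R Q) $ x $ y" for x y
  proof -
    have "transition P X x y 1 = matrix_exp (1 *\<^sub>R Q) $ x $ y"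
      using Q unfolding is_generator_matrix_def by (metis zero_le_one)
    then show ?thesis using irr unfolding irreducible_process_def by (metis zero_less_one)
  qed
  show "0 < pmf \<pi> y" for y
  proof -
    obtain x where x: "x \<in> set_pmf \<pi>" using set_pmf_not_empty by fast
    then have "0 < pmf \<pi> x * matrix_exp (1 *\<^sub>R Q) $ x $ y"
      using p[of x y] by (simp add: pmf_positive)
    also have "\<dots> \<le> (\<Sum>x\<in>UNIV. pmf \<pi> x * matrix_exp (1 *\<^sub>R Q) $ x $ y)"
      by (rule member_le_sum[OF UNIV_I _ finite]) (rule mult_nonneg_nonneg[OF pmf_nonneg less_imp_le[OF p]])
    also have "\<dots> = pmf \<pi> y" by (rule matrix_exp_invariant[OF inv])
    finally show ?thesis .
  qed
  show "2 \<le> CARD('e)" "invariant_distribution Q \<pi>" by fact+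
  show "x \<noteq> y \<Longrightarrow> 0 \<le> Q $ x $ y" and row: "(\<Sum>y\<in>UNIV. Q $ x $ y) = 0" for x y
    using Q by (auto simp: is_generator_matrix_def)
  fix g :: "'e \<Rightarrow> real" and x y
  assume g: "generator Q g = (\<lambda>_. 0)"
  have "generator Q (\<lambda>_. 1) = (\<lambda>_. 0)" by (simp add: generator_def row)
  from matrix_exp_harmonic[OF this, of 1]
  have one: "(\<Sum>y\<in>UNIV. matrix_exp (1 *\<^sub>R Q) $ x $ y) = 1" for x by simp
  have "Max (range g) \<in> range g" by (intro Max_in) auto
  then obtain z where "g z = Max (range g)" by (metis imageE)
  then have z: "g y \<le> g z" for y by simp
  have "(\<Sum>y\<in>UNIV. matrix_exp (1 *\<^sub>R Q) $ z $ y * (g z - g y))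
      = (\<Sum>y\<in>UNIV. matrix_exp (1 *\<^sub>R Q) $ z $ y) * g z - (\<Sum>y\<in>UNIV. matrix_exp (1 *\<^sub>R Q) $ z $ y * g y)"
    by (simp add: right_diff_distrib sum_subtractf sum_distrib_right)
  also have "\<dots> = 0"
    unfolding one matrix_exp_harmonic[OF g] by simp
  finally have "\<forall>y\<in>UNIV. matrix_exp (1 *\<^sub>R Q) $ z $ y * (g z - g y) = 0"
    using z p[THEN less_imp_le] by (subst (asm) sum_nonneg_eq_0_iff) (auto simp del: scaleR_one)
  then have "g y = g z" for y
    using p[of z y] by (metis UNIV_I eq_iff_diff_eq_0 less_irrefl mult_eq_0_iff)
  then show "g x = g y" by metis
qed

text \<open>
  The \<open>r\<close> chosen here is the minimizer of \<open>r\<^sup>2 a / (1 - b r) - r u\<close> on \<open>0 \<le> r < 1 / b\<close>. The substitution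
  \<open>u = a (s\<^sup>2 - 1) / b\<close> makes everything rational in \<open>s\<close>, in particular \<open>1 - b r = 1 / s\<close>.
\<close>
lemma bernstein_exponent:
  fixes a b u :: real
  assumes "0 < a" "0 < b" "0 \<le> u"
  defines "s \<equiv> sqrt (1 + b * u / a)"
  defines "r \<equiv> (1 - 1 / s) / b"
  shows "0 \<le> r" "b * r < 1" "r\<^sup>2 * a / (1 - b * r) - r * u = - (u\<^sup>2 / (a * (1 + s)\<^sup>2))"
proof -
  have "0 \<le> b * u / a" using assms(1-3) by simp
  then have s: "1 \<le> s" by (simp add: s_def)
  then show "0 \<le> r" using assms(2) by (simp add: r_def)
  have br: "1 - b * r = 1 / s" using assms(2) by (simp add: r_def)
  then show "b * r < 1" using s by (metis diff_gt_0_iff_gt less_le_trans zero_less_divide_1_iff zero_less_one)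
  have "s\<^sup>2 = 1 + b * u / a" using \<open>0 \<le> b * u / a\<close> by (simp add: s_def)
  then have u: "u = a * ((s - 1) * (s + 1)) / b" using assms(1,2) by (simp add: field_simps power2_eq_square)
  have r: "r = (s - 1) / (b * s)" using s assms(2) by (simp add: r_def field_simps)
  have ne: "1 + s \<noteq> 0" using s by simp
  have "u / (1 + s) = a * (s - 1) / b"
    by (rule eq_divide_imp[OF ne, symmetric]) (simp add: u add.commute)
  then have "u\<^sup>2 / (a * (1 + s)\<^sup>2) = (a * (s - 1) / b)\<^sup>2 / a"
    by (metis divide_divide_eq_left mult.commute power_divide)
  also have "\<dots> = a * (s - 1)\<^sup>2 / b\<^sup>2"
    using assms(1) by (simp add: power2_eq_square)
  finally have R: "u\<^sup>2 / (a * (1 + s)\<^sup>2) = a * (s - 1)\<^sup>2 / b\<^sup>2" .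
  have "r\<^sup>2 * a / (1 - b * r) = a * (s - 1)\<^sup>2 / (b\<^sup>2 * s)"
    unfolding br unfolding r using s by (simp add: power2_eq_square mult_ac)
  moreover have "r * u = a * (s - 1)\<^sup>2 * (s + 1) / (b\<^sup>2 * s)"
    unfolding r u by (simp add: power2_eq_square mult_ac)
  ultimately have "r\<^sup>2 * a / (1 - b * r) - r * u = (a * (s - 1)\<^sup>2 - a * (s - 1)\<^sup>2 * (s + 1)) / (b\<^sup>2 * s)"
    by (simp only: diff_divide_distrib)
  also have "a * (s - 1)\<^sup>2 - a * (s - 1)\<^sup>2 * (s + 1) = - (a * (s - 1)\<^sup>2) * s"
    by (simp add: algebra_simps)
  also have "- (a * (s - 1)\<^sup>2) * s / (b\<^sup>2 * s) = - (a * (s - 1)\<^sup>2 / b\<^sup>2)"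
    using s by simp
  finally show "r\<^sup>2 * a / (1 - b * r) - r * u = - (u\<^sup>2 / (a * (1 + s)\<^sup>2))"
    unfolding R .
qed

theorem theorem3p3p43:
  fixes M :: "'w measure"
    and P :: "'e::finite \<Rightarrow> 'w measure"
    and X :: "real \<Rightarrow> 'w \<Rightarrow> 'e"
    and Q :: "real ^ 'e ^ 'e"
    and \<pi> \<nu> :: "'e pmf"
    and f :: "'e \<Rightarrow> real"
  assumes "CARD('e) \<ge> 2"
    and "markov_jump_process M P X"
    and "irreducible_process P X"
    and "is_generator_matrix P X Q"
    and "invariant_distribution Q \<pi>"
    and "\<not> f constant_on UNIV"
    and "measure_pmf.expectation \<pi> f = 0"
  shows "(\<forall>t>0. \<forall>u\<ge>0.
            prob_from P \<nu> {\<omega> \<in> space M. additive_functional X f t \<omega> / t \<ge> u}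
            \<le> l2_norm \<pi> (rel_density \<nu> \<pi>) *
               exp (- (2 * t * u\<^sup>2 /
                 (sigma2 \<pi> Q f *
                  (1 + sqrt (1 + 2 * sup_norm (pos_part f) * u /
                                 (spectral_gap \<pi> Q * sigma2 \<pi> Q f)))\<^sup>2)))) \<and>
         (\<forall>r. 0 \<le> r \<and> r < spectral_gap \<pi> Q / sup_norm (pos_part f) \<longrightarrow>
            lambda0 \<pi> Q f r
            \<le> (r\<^sup>2 * sigma2 \<pi> Q f / 2) /
               (1 - (sup_norm (pos_part f) / spectral_gap \<pi> Q) * r))"
proof -
  interpret markov_jump_process M P X by fact
  interpret ergodic_generator \<pi> Q
    by (rule irreducible_imp_ergodic_generator) fact+
  have f0: "l2_inner \<pi> f one = 0"
    using assms(7) by (simp add: expectation_eq_l2_inner_one)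
  have fnz: "f \<noteq> (\<lambda>_. 0)"
    using assms(6) by (auto simp: constant_on_def)
  define a b where "a = sigma2 \<pi> Q f / 2" and "b = sup_norm (pos_part f) / spectral_gap \<pi> Q"
  have a: "0 < a" using sigma2_pos[OF f0 fnz] by (simp add: a_def)
  have F: "0 < sup_norm (pos_part f)" by (rule sup_norm_pos_part_pos[OF f0 fnz])
  then have b: "0 < b" using spectral_gap_pos by (simp add: b_def)
  have form: "l2_inner \<pi> (T g) g + r * l2_inner \<pi> (\<lambda>x. f x * g x) g \<le> r\<^sup>2 * a / (1 - b * r) * l2_inner \<pi> g g"
    if "0 \<le> r" "b * r < 1" for r g
    using perturbed_form_bound[OF f0, of r g] that by (simp add: a_def b_def)
  show ?thesis
  proof (intro conjI allI impI)
    fix t u :: real assume t: "0 < t" and u: "0 \<le> u"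
    define s where "s = sqrt (1 + b * u / a)"
    define r where "r = (1 - 1 / s) / b"
    define c where "c = r\<^sup>2 * a / (1 - b * r)"
    note r = bernstein_exponent[OF a b u, folded s_def, folded r_def, folded c_def]
    have "prob_from P \<nu> {\<omega> \<in> space M. additive_functional X f t \<omega> / t \<ge> u}
        \<le> (\<Sum>x\<in>UNIV. pmf \<nu> x * (exp (- (r * u * t)) * (\<integral>\<omega>. exp (r * additive_functional X f t \<omega>) \<partial>P x)))"
      unfolding prob_from_def by (intro sum_mono mult_left_mono chernoff t r(1)) auto
    also have "\<dots> = exp (- (r * u * t)) * (\<Sum>x\<in>UNIV. pmf \<nu> x * (\<integral>\<omega>. exp (r * additive_functional X f t \<omega>) \<partial>P x))"
      by (simp add: sum_distrib_left mult_ac)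
    also have "\<dots> \<le> exp (- (r * u * t)) * (l2_norm \<pi> (rel_density \<nu> \<pi>) * exp (t * c))"
    proof (intro mult_left_mono exp_moment_bound[where Q = Q])
      show "full_support \<pi>" by unfold_locales
      show "l2_inner \<pi> (generator Q g) g + r * l2_inner \<pi> (\<lambda>x. f x * g x) g \<le> c * l2_inner \<pi> g g" for g
        using form[OF r(1,2), of g] by (simp add: T_quadratic c_def)
    qed (use assms(4) t in auto)
    also have "\<dots> = l2_norm \<pi> (rel_density \<nu> \<pi>) * exp (t * (c - r * u))"
      by (simp add: algebra_simps flip: exp_add)
    also have "t * (c - r * u) = - (2 * t * u\<^sup>2 / (sigma2 \<pi> Q f * (1 + s)\<^sup>2))"
      unfolding r(3) by (simp add: a_def)
    also have "s = sqrt (1 + 2 * sup_norm (pos_part f) * u / (spectral_gap \<pi> Q * sigma2 \<pi> Q f))"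
      by (simp add: s_def a_def b_def mult_ac)
    finally show "prob_from P \<nu> {\<omega> \<in> space M. additive_functional X f t \<omega> / t \<ge> u}
        \<le> l2_norm \<pi> (rel_density \<nu> \<pi>) *
           exp (- (2 * t * u\<^sup>2 / (sigma2 \<pi> Q f * (1 + sqrt (1 + 2 * sup_norm (pos_part f) * u /
             (spectral_gap \<pi> Q * sigma2 \<pi> Q f)))\<^sup>2)))" .
  next
    fix r assume r: "0 \<le> r \<and> r < spectral_gap \<pi> Q / sup_norm (pos_part f)"
    then have "b * r < 1"
      using F spectral_gap_pos by (simp add: b_def field_simps)
    then have "lambda0 \<pi> Q f r \<le> r\<^sup>2 * a / (1 - b * r)"
      using r by (intro lambda0_le form) auto
    then show "lambda0 \<pi> Q f r \<le> (r\<^sup>2 * sigma2 \<pi> Q f / 2) / (1 - (sup_norm (pos_part f) / spectral_gap \<pi> Q) * r)"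
      by (simp add: a_def b_def)
  qed
qed

end
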